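(* Let $\natural: U^+_q \to \mathbb V$ be the algebra homomorphism from $U^+_q$ to the $q$-shuffle algebra $(\mathbb V,\star)$ that sends $A\mapsto x$ and $B\mapsto y$. Then for every integer $n\geq 1$, \[ \natural\bigl(E^{\rm Beck}_{n\delta}\bigr) = \frac{[2n]_q}{n}\, q^{-2n}(q-q^{-1})^{2n-1}\, x C_{n-1} y , \] where $xC_{n-1}y$ denotes the free (concatenation) product in $\mathbb V$.
   Context: $\mathbb F$ is a field of characteristic zero and $q\in\mathbb F$ is nonzero and not a root of unity; $[n]_q=(q^n-q^{-n})/(q-q^{-1})$. For elements $X,Y$ of an algebra, $[X,Y]=XY-YX$ and $[X,Y]_q=qXY-q^{-1}YX$. $U^+_q$ is the $\mathbb F$-algebra with generators $A,B$ and relations $[A,[A,[A,B]_q]_{q^{-1}}]=0$, $[B,[B,[B,A]_q]_{q^{-1}}]=0$. Define elements of $U^+_q$ recursively: $E_{\alpha_0}=A$, $E_{\alpha_1}=B$, $E_\delta=q^{-2}BA-AB$, and for $n\geq1$: $E_{n\delta+\alpha_0}=[E_\delta,E_{(n-1)\delta+\alpha_0}]/(q+q^{-1})$, $E_{n\delta+\alpha_1}=[E_{(n-1)\delta+\alpha_1},E_\delta]/(q+q^{-1})$, $E_{n\delta}=q^{-2}E_{(n-1)\delta+\alpha_1}A-AE_{(n-1)\delta+\alpha_1}$. Define $\{E^{\rm Beck}_{n\delta}\}_{n\ge1}\subseteq U^+_q$ by the identity of formal power series in an indeterminate $t$: $\exp\bigl((q-q^{-1})\sum_{k\ge1}E^{\rm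 Beck}_{k\delta}t^k\bigr)=1-(q-q^{-1})\sum_{k\ge1}E_{k\delta}t^k$. $\mathbb V$ is the free algebra on noncommuting letters $x,y$; a word is a product of letters (the empty word is $1$), and words form a basis. The $q$-shuffle product $\star$ on $\mathbb V$ is the bilinear product with $1\star v=v\star 1=v$ and, for nontrivial words $u=u_1\cdots u_r$, $v=v_1\cdots v_s$ (letters $u_i,v_j$), $u\star v=u_1\bigl((u_2\cdots u_r)\star v\bigr)+v_1\bigl(u\star(v_2\cdots v_s)\bigr)q^{(u_1,v_1)+(u_2,v_1)+\cdots+(u_r,v_1)}$, where juxtaposition is concatenation and $(x,x)=(y,y)=2$, $(x,y)=(y,x)=-2$. This makes $\mathbb V$ an associative algebra in which $x,y$ satisfy the $q$-Serre relations, so $\natural$ exists. Set $\overline x=1$, $\overline y=-1$. A word $u_1\cdots u_n$ is Catalan if $\overline u_1+\cdots+\overline u_i\ge0$ for $1\le i\le n-1$ and $=0$ for $i=n$. For $n\in\mathbb N$, $C_n=\sum u_1u_2\cdots u_{2n}\,[1]_q[1+\overline u_1]_q[1+\overline u_1+\overline u_2]_q\cdots[1+\overline u_1+\cdots+\overline u_{2n}]_q$, summed over all Catalan words of length $2n$ (so $C_0=1$). *)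

theory Defs
  imports Main
begin

datatype letter = X | Y

instance letter :: finite
proof
  have "(UNIV :: letter set) = {X, Y}" using letter.exhaust by auto
  then show "finite (UNIV :: letter set)" by (metis finite.emptyI finite.insertI)
qed

text \<open>Elements of the free algebra on two letters (and of V) are represented by their
  coefficient functions on words; all elements that occur are finitely supported.\<close>
type_synonym 'a vec = "letter list \<Rightarrow> 'a"

definition single :: "letter list \<Rightarrow> 'a::zero_neq_one vec" where
  "single u = (\<lambda>w. if w = u then 1 else 0)"

definition vadd :: "'a::ab_group_add vec \<Rightarrow> 'a vec \<Rightarrow> 'a vec" where
  "vadd f g = (\<lambda>w. f w + g w)"

definition vsub :: "'a::ab_group_add vec \<Rightarrow> 'a vec \<Rightarrow> 'a vec" where
  "vsub f g = (\<lambda>w. f w - g w)"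

definition vscale :: "'a::times \<Rightarrow> 'a vec \<Rightarrow> 'a vec" where
  "vscale s f = (\<lambda>w. s * f w)"

definition conc :: "'a::comm_ring_1 vec \<Rightarrow> 'a vec \<Rightarrow> 'a vec" where
  "conc f g = (\<lambda>w. \<Sum>i\<le>length w. f (take i w) * g (drop i w))"

fun cprod :: "'a::comm_ring_1 vec list \<Rightarrow> 'a vec" where
  "cprod [] = single []"
| "cprod (f # fs) = conc f (cprod fs)"

definition ip :: "letter \<Rightarrow> letter \<Rightarrow> int" where
  "ip a b = (if a = b then 2 else -2)"

definition prep :: "letter \<Rightarrow> 'a::zero vec \<Rightarrow> 'a vec" where
  "prep a f = (\<lambda>w. case w of [] \<Rightarrow> 0 | c # w' \<Rightarrow> if c = a then f w' else 0)"

fun shuf :: "'a::field \<Rightarrow> letter list \<Rightarrow> letter list \<Rightarrow> 'a vec" where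
  "shuf q [] v = single v"
| "shuf q (a # u) [] = single (a # u)"
| "shuf q (a # u) (b # v) =
     (\<lambda>w. prep a (shuf q u (b # v)) w
          + q powi (\<Sum>c\<leftarrow>a # u. ip c b) * prep b (shuf q (a # u) v) w)"

definition star :: "'a::field \<Rightarrow> 'a vec \<Rightarrow> 'a vec \<Rightarrow> 'a vec" where
  "star q f g = (\<lambda>w. \<Sum>u\<in>{u. length u \<le> length w}. \<Sum>v\<in>{v. length v \<le> length w}.
                       f u * g v * shuf q u v w)"

section \<open>The homomorphism natural, precomposed with the free algebra on A, B\<close>

text \<open>Image of a word in A (=X), B (=Y) under natural: the star product of its letters.\<close>
fun wimg :: "'a::field \<Rightarrow> letter list \<Rightarrow> 'a vec" where
  "wimg q [] = single []"
| "wimg q (a # w) = star q (single [a]) (wimg q w)"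

definition natural :: "'a::field \<Rightarrow> 'a vec \<Rightarrow> 'a vec" where
  "natural q f = (\<lambda>v. \<Sum>w\<in>{w. f w \<noteq> 0}. f w * wimg q w v)"

section \<open>The elements E (lifted to the free algebra on A, B)\<close>

definition fA :: "'a::zero_neq_one vec" where "fA = single [X]"
definition fB :: "'a::zero_neq_one vec" where "fB = single [Y]"

definition Edelta1 :: "'a::field \<Rightarrow> 'a vec" where
  "Edelta1 q = vsub (vscale (q powi (-2)) (conc fB fA)) (conc fA fB)"

fun Ea1 :: "'a::field \<Rightarrow> nat \<Rightarrow> 'a vec" where
  "Ea1 q 0 = fB"
| "Ea1 q (Suc n) = vscale (1 / (q + inverse q))
                     (vsub (conc (Ea1 q n) (Edelta1 q)) (conc (Edelta1 q) (Ea1 q n)))"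

text \<open>Edel q n is E_{n delta}, for n >= 1.\<close>
definition Edel :: "'a::field \<Rightarrow> nat \<Rightarrow> 'a vec" where
  "Edel q n = vsub (vscale (q powi (-2)) (conc (Ea1 q (n - 1)) fA)) (conc fA (Ea1 q (n - 1)))"

definition comps :: "nat \<Rightarrow> nat \<Rightarrow> nat list set" where
  "comps n m = {ks. length ks = m \<and> (\<forall>k\<in>set ks. 0 < k) \<and> sum_list ks = n}"

text \<open>Coefficient of t^n in exp(sum_{k>=1} a_k t^k), computed with the free product.\<close>
definition expco :: "(nat \<Rightarrow> 'a::field_char_0 vec) \<Rightarrow> nat \<Rightarrow> 'a vec" where
  "expco a n = (\<lambda>w. \<Sum>m\<le>n. (1 / fact m) * (\<Sum>ks\<in>comps n m. cprod (map a ks) w))"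

definition qint :: "'a::field \<Rightarrow> int \<Rightarrow> 'a" where
  "qint q n = (q powi n - q powi (-n)) / (q - inverse q)"

definition bar :: "letter \<Rightarrow> int" where
  "bar a = (if a = X then 1 else -1)"

definition psum :: "letter list \<Rightarrow> nat \<Rightarrow> int" where
  "psum w i = (\<Sum>j<i. bar (w ! j))"

definition catalan :: "letter list \<Rightarrow> bool" where
  "catalan w \<longleftrightarrow> (\<forall>i. 1 \<le> i \<and> i < length w \<longrightarrow> psum w i \<ge> 0) \<and> psum w (length w) = 0"

definition Cat :: "'a::field \<Rightarrow> nat \<Rightarrow> 'a vec" where
  "Cat q n = (\<lambda>w. if length w = 2 * n \<and> catalan w
                   then (\<Prod>i\<le>2 * n. qint q (1 + psum w i)) else 0)"

end

theory Submission
  imports Defs "HOL-Library.Function_Algebras" "HOL.Vector_Spaces"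
begin

text \<open>
  Deleting the first letter, or the last letter, of a word is a twisted derivation of the \<open>q\<close>-shuffle product, and a vector
  is determined by its constant coefficient and its images under the deletions on one side. So identities
  in the \<open>q\<close>-shuffle algebra can be proved by induction on the degree.

  Two identities are checked coefficientwise, by induction on the prefixes of a word: \<open>C\<^sub>n\<close> commutes with \<open>xy\<close>, and
  \<open>q\<^sup>2 x \<star> C\<^sub>n y - C\<^sub>n y \<star> x = (q - q\<^sup>-\<^sup>1) C\<^sub>n\<^sub>+\<^sub>1\<close>. They imply the images of the elements \<open>E\<close>, and, by deletions and commutators with
  \<open>xy\<close>, that \<open>x C\<^sub>k y\<close> commutes with every \<open>C\<^sub>n\<close>, that its commutator with \<open>C\<^sub>n y\<close> is \<open>(q - q\<^sup>-\<^sup>1) C\<^sub>n\<^sub>+\<^sub>k\<^sub>+\<^sub>1 y\<close>, and that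
  the \<open>x C\<^sub>k y\<close> commute with each other. Deleting the first letter then gives
  \<open>n C\<^sub>n = \<Sum>\<^sub>k [2k+2] (x C\<^sub>k y) \<star> C\<^sub>n\<^sub>-\<^sub>1\<^sub>-\<^sub>k\<close>, which is the logarithmic derivative of
  \<open>exp (\<Sum>\<^sub>k [2k]/k x C\<^sub>k\<^sub>-\<^sub>1 y t\<^sup>k) = \<Sum>\<^sub>n C\<^sub>n t\<^sup>n\<close>; the coefficients of an exponential determine its exponent.
\<close>

section \<open>The q-shuffle product\<close>

lemma vsub_eq: "vsub f g = f - g"
  by (simp add: vsub_def fun_eq_iff)

lemma vscale_apply [simp]: "vscale s f w = s * f w"
  by (simp add: vscale_def)

lemma sum_fun_at: "(\<Sum>i\<in>I. (f i :: 'b \<Rightarrow> 'c::comm_monoid_add)) w = (\<Sum>i\<in>I. f i w)"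
  by (induction I rule: infinite_finite_induct) auto

definition lev :: "letter list \<Rightarrow> int" where
  "lev w = sum_list (map bar w)"

lemma lev_simps [simp]: "lev [] = 0" "lev (a # w) = bar a + lev w" "lev (u @ v) = lev u + lev v"
  by (auto simp: lev_def)

lemma bar_simps [simp]: "bar X = 1" "bar Y = -1"
  by (auto simp: bar_def)

text \<open>Since \<open>ip c a = 2 * bar a * bar c\<close>, the power of q picked up by a letter
  depends only on the level of the word it passes.\<close>

lemma sum_ip: "(\<Sum>c\<leftarrow>w. ip c a) = 2 * bar a * lev w"
proof (induction w)
  case (Cons c w)
  have "ip c a = 2 * bar a * bar c" by (cases c; cases a) (auto simp: ip_def)
  with Cons show ?case by (simp add: algebra_simps)
qed simp

abbreviation words :: "nat \<Rightarrow> letter list set" where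
  "words n \<equiv> {u. length u \<le> n}"

lemma finite_words: "finite (words n)"
  using finite_lists_length_le[of "UNIV :: letter set" n] by simp

lemma sum_words_Suc:
  fixes F :: "letter list \<Rightarrow> 'b::comm_monoid_add"
  shows "(\<Sum>u\<in>words (Suc n). F u) = F [] + (\<Sum>u\<in>words n. F (X # u)) + (\<Sum>u\<in>words n. F (Y # u))"
proof -
  have *: "words (Suc n) = insert [] ((#) X ` words n \<union> (#) Y ` words n)"
  proof (rule set_eqI)
    fix u show "u \<in> words (Suc n) \<longleftrightarrow> u \<in> insert [] ((#) X ` words n \<union> (#) Y ` words n)"
    proof (cases u)
      case (Cons a u') then show ?thesis by (cases a) (auto simp: image_iff)
    qed simp
  qed
  have "sum F ((#) X ` words n \<union> (#) Y ` words n) = sum F ((#) X ` words n) + sum F ((#) Y ` words n)"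
    by (rule sum.union_disjoint) (use finite_words[of n] in auto)
  then show ?thesis unfolding * using finite_words[of n]
    by (subst sum.insert) (auto simp: sum.reindex add.assoc)
qed

text \<open>The recursion is read off the first letter of the result, so that inductions run over
  the output word alone.\<close>

lemma shuf_Cons:
  "shuf q u v (c # w) =
     (case u of [] \<Rightarrow> 0 | a # u' \<Rightarrow> if a = c then shuf q u' v w else 0)
   + (case v of [] \<Rightarrow> 0 | b # v' \<Rightarrow> if b = c then q powi (2 * bar b * lev u) * shuf q u v' w else 0)"
proof (cases u)
  case Nil
  then show ?thesis by (cases v) (auto simp: single_def)
next
  case (Cons a u')
  have "shuf q u' [] = (single u' :: 'a vec)" by (cases u') auto
  with Cons show ?thesis
    by (cases v) (auto simp: single_def prep_def sum_ip[of _ "a # u'"] simp del: lev_simps(2) list.map(2) sum_list.Cons)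
qed

lemma shuf_Nil: "shuf q u v [] = (if u = [] \<and> v = [] then 1 else 0)"
  by (cases u; cases v) (auto simp: single_def prep_def)

text \<open>A shuffle keeps every letter, so the product is graded by length and by level.\<close>

lemma shuf_nonzero: "shuf q u v w \<noteq> 0 \<Longrightarrow> length w = length u + length v \<and> lev w = lev u + lev v"
proof (induction w arbitrary: u v)
  case Nil
  then show ?case by (auto simp: shuf_Nil split: if_splits)
next
  case (Cons c w)
  from Cons.prems consider u' where "u = c # u'" "shuf q u' v w \<noteq> 0" | v' where "v = c # v'" "shuf q u v' w \<noteq> 0"
    unfolding shuf_Cons by (cases u; cases v; force split: if_splits)
  then show ?case using Cons.IH by cases fastforce+
qed

section \<open>Deletion of outer letters\<close>

definition ldel :: "letter \<Rightarrow> 'a vec \<Rightarrow> 'a vec" where "ldel a f = (\<lambda>w. f (a # w))"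
definition rdel :: "letter \<Rightarrow> 'a vec \<Rightarrow> 'a vec" where "rdel a f = (\<lambda>w. f (w @ [a]))"

lemma rdel_apply: "rdel a f w = f (w @ [a])" by (simp add: rdel_def)

lemma vec_eqI_left: "f [] = g [] \<Longrightarrow> ldel X f = ldel X g \<Longrightarrow> ldel Y f = ldel Y g \<Longrightarrow> f = g"
proof (rule ext)
  fix w assume *: "f [] = g []" "ldel X f = ldel X g" "ldel Y f = ldel Y g"
  show "f w = g w"
  proof (cases w)
    case (Cons a u) with * show ?thesis by (cases a) (auto simp: ldel_def fun_eq_iff)
  qed (simp add: *)
qed

lemma vec_eqI_right: "f [] = g [] \<Longrightarrow> rdel X f = rdel X g \<Longrightarrow> rdel Y f = rdel Y g \<Longrightarrow> f = g"
proof (rule ext)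
  fix w assume *: "f [] = g []" "rdel X f = rdel X g" "rdel Y f = rdel Y g"
  show "f w = g w"
  proof (cases w rule: rev_cases)
    case (snoc u a) with * show ?thesis by (cases a) (auto simp: rdel_def fun_eq_iff)
  qed (simp add: *)
qed

lemma ldel_linear:
  fixes f g :: "'a::field vec"
  shows "ldel a (f + g) = ldel a f + ldel a g" "ldel a (f - g) = ldel a f - ldel a g"
    "ldel a (vscale s f) = vscale s (ldel a f)" "ldel a 0 = (0 :: 'a vec)" "ldel a (- f) = - ldel a f"
    "ldel a (\<Sum>i\<in>I. h i) = (\<Sum>i\<in>I. ldel a (h i :: 'a vec))"
  by (auto simp: fun_eq_iff ldel_def sum_fun_at)

lemma rdel_linear:
  fixes f g :: "'a::field vec"
  shows "rdel a (f + g) = rdel a f + rdel a g" "rdel a (f - g) = rdel a f - rdel a g"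
    "rdel a (vscale s f) = vscale s (rdel a f)" "rdel a 0 = (0 :: 'a vec)" "rdel a (- f) = - rdel a f"
  by (auto simp: fun_eq_iff rdel_def)

text \<open>By the length grading longer words contribute nothing, so the two bounds may be enlarged
  independently; \<open>star_Cons\<close> needs unequal bounds.\<close>

lemma star_bound:
  assumes "length w \<le> n" "length w \<le> m"
  shows "star q f g w = (\<Sum>u\<in>words n. \<Sum>v\<in>words m. f u * g v * shuf q u v w)"
proof -
  have "(\<Sum>u\<in>words n. \<Sum>v\<in>words m. f u * g v * shuf q u v w)
      = (\<Sum>u\<in>words n. \<Sum>v\<in>words (length w). f u * g v * shuf q u v w)"
    by (intro sum.cong refl sum.mono_neutral_right finite_words) (use assms shuf_nonzero in fastforce)+
  also have "\<dots> = (\<Sum>u\<in>words (length w). \<Sum>v\<in>words (length w). f u * g v * shuf q u v w)"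
    using assms by (intro sum.mono_neutral_right finite_words ballI sum.neutral) (auto dest!: shuf_nonzero)
  finally show ?thesis by (simp add: star_def)
qed

text \<open>Only pairs of complementary length and level contribute. A factor may thus be replaced
  by anything that agrees with it in the relevant bidegree.\<close>

lemma star_cong:
  assumes "\<And>u v. length w = length u + length v \<Longrightarrow> lev w = lev u + lev v \<Longrightarrow> f u * g v = f' u * g' v"
  shows "star q f g w = star q f' g' w"
  unfolding star_def
proof (intro sum.cong refl)
  fix u v show "f u * g v * shuf q u v w = f' u * g' v * shuf q u v w"
    using assms[of u v] shuf_nonzero[of q u v w] by (cases "shuf q u v w = 0") auto
qed

lemma star_linear:
  fixes f g :: "'a::field vec"
  shows "star q (f + g) h = star q f h + star q g h" "star q h (f + g) = star q h f + star q h g"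
    "star q (f - g) h = star q f h - star q g h" "star q h (f - g) = star q h f - star q h g"
    "star q (vscale s f) h = vscale s (star q f h)" "star q h (vscale s f) = vscale s (star q h f)"
    "star q (- f) h = - star q f h" "star q h (- f) = - star q h f"
    "star q 0 h = 0" "star q h 0 = 0"
  by (auto simp: star_def fun_eq_iff algebra_simps sum.distrib sum_subtractf sum_distrib_left sum_negf)

lemma star_sum:
  fixes h :: "'a::field vec"
  shows "star q (\<Sum>i\<in>I. f i) h = (\<Sum>i\<in>I. star q (f i) h)" "star q h (\<Sum>i\<in>I. f i) = (\<Sum>i\<in>I. star q h (f i))"
  by (induction I rule: infinite_finite_induct) (auto simp: star_linear)

section \<open>The twist, the Leibniz rules and associativity\<close>

definition wgt :: "'a::field \<Rightarrow> letter \<Rightarrow> 'a vec \<Rightarrow> 'a vec" where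
  "wgt q a f = (\<lambda>w. q powi (2 * bar a * lev w) * f w)"

lemma star_Nil: "star q f g [] = f [] * g []"
proof -
  have "words 0 = {[]}" by auto
  then show ?thesis by (simp add: star_def shuf_Nil single_def)
qed

text \<open>The first letter of a product stems from \<open>f\<close>, or from \<open>g\<close>
  after passing all of \<open>f\<close>; the passage costs the power of q in
  \<open>wgt\<close>.\<close>

lemma star_Cons:
  "star q f g (c # w) = star q (ldel c f) g w + star q (wgt q c f) (ldel c g) w"
proof -
  let ?n = "length w"
  let ?P = "\<lambda>u v. case u of [] \<Rightarrow> 0 | a # u' \<Rightarrow> if a = c then shuf q u' v w else 0"
  let ?Q = "\<lambda>u v. case v of [] \<Rightarrow> 0 | b # v' \<Rightarrow> if b = c then q powi (2 * bar b * lev u) * shuf q u v' w else 0"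
  have "star q f g (c # w) = (\<Sum>u\<in>words (Suc ?n). \<Sum>v\<in>words (Suc ?n). f u * g v * ?P u v)
      + (\<Sum>u\<in>words (Suc ?n). \<Sum>v\<in>words (Suc ?n). f u * g v * ?Q u v)"
    unfolding star_def shuf_Cons by (simp add: algebra_simps sum.distrib)
  moreover have "(\<Sum>u\<in>words (Suc ?n). \<Sum>v\<in>words (Suc ?n). f u * g v * ?P u v)
      = (\<Sum>u\<in>words ?n. \<Sum>v\<in>words (Suc ?n). ldel c f u * g v * shuf q u v w)"
    by (subst sum_words_Suc) (cases c; simp add: ldel_def)
  moreover have "(\<Sum>u\<in>words (Suc ?n). \<Sum>v\<in>words (Suc ?n). f u * g v * ?Q u v)
      = (\<Sum>u\<in>words (Suc ?n). \<Sum>v\<in>words ?n. wgt q c f u * ldel c g v * shuf q u v w)"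
    by (rule sum.cong[OF refl], subst sum_words_Suc) (cases c; simp add: ldel_def wgt_def mult_ac)
  ultimately show ?thesis
    using star_bound[of w ?n "Suc ?n" q "ldel c f" g] star_bound[of w "Suc ?n" ?n q "wgt q c f" "ldel c g"] by simp
qed

lemma ldel_star: "ldel a (star q f g) = star q (ldel a f) g + star q (wgt q a f) (ldel a g)"
  by (simp add: fun_eq_iff star_Cons ldel_def)

lemma wgt_star: "q \<noteq> 0 \<Longrightarrow> wgt q a (star q f g) = star q (wgt q a f) (wgt q a g)"
proof (rule ext)
  fix w assume "q \<noteq> 0"
  have "star q (wgt q a f) (wgt q a g) w = star q (vscale (q powi (2 * bar a * lev w)) f) g w"
    by (rule star_cong) (use \<open>q \<noteq> 0\<close> in \<open>simp add: wgt_def distrib_left power_int_add\<close>)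
  then show "wgt q a (star q f g) w = star q (wgt q a f) (wgt q a g) w"
    by (simp add: star_linear wgt_def)
qed

lemma ldel_wgt: "q \<noteq> 0 \<Longrightarrow> ldel b (wgt q a g) = vscale (q powi (2 * bar a * bar b)) (wgt q a (ldel b g))"
  by (simp add: wgt_def ldel_def fun_eq_iff distrib_left power_int_add)

lemma wgt_rdel: "q \<noteq> 0 \<Longrightarrow> rdel a (wgt q b f) = vscale (q powi (2 * bar a * bar b)) (wgt q b (rdel a f))"
  by (simp add: wgt_def rdel_def fun_eq_iff distrib_left power_int_add ac_simps)

text \<open>Deleting the first letter turns both sides into the same three terms, because
  \<open>wgt\<close> is multiplicative.\<close>

lemma star_assoc:
  assumes "q \<noteq> 0" shows "star q (star q f g) h = star q f (star q g h)"
proof (rule ext)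
  fix w show "star q (star q f g) h w = star q f (star q g h) w"
    by (induction w arbitrary: f g h)
       (simp_all add: star_Nil star_Cons ldel_star star_linear wgt_star[OF assms] add.assoc)
qed

text \<open>Here the last letter of \<open>f\<close> has to pass \<open>g\<close>, so the twist sits
  on \<open>g\<close>. First- and last-letter deletion commute, and the scalars from
  \<open>ldel_wgt\<close> and \<open>wgt_rdel\<close> agree by symmetry in the two letters.\<close>

lemma rdel_star:
  assumes "q \<noteq> 0" shows "rdel a (star q f g) = star q f (rdel a g) + star q (rdel a f) (wgt q a g)"
proof (rule ext)
  fix w show "rdel a (star q f g) w = (star q f (rdel a g) + star q (rdel a f) (wgt q a g)) w"
  proof (induction w arbitrary: f g)
    case Nil
    show ?case by (simp add: star_Nil star_Cons ldel_def rdel_def wgt_def)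
  next
    case (Cons b w)
    have s: "ldel b (rdel a k) = rdel a (ldel b k)" for k :: "'a vec"
      by (simp add: ldel_def rdel_def)
    have "rdel a (star q f g) (b # w) = rdel a (star q (ldel b f) g) w + rdel a (star q (wgt q b f) (ldel b g)) w"
      by (simp add: rdel_def star_Cons)
    also have "\<dots> = (star q f (rdel a g) + star q (rdel a f) (wgt q a g)) (b # w)"
      unfolding Cons.IH by (simp add: star_Cons s ldel_wgt[OF assms] wgt_rdel[OF assms] star_linear mult_ac)
    finally show ?case .
  qed
qed

lemma star_one [simp]: "star q (single []) f = f" "star q f (single []) = f"
proof -
  have 1: "star q (single []) f w = f w" for w
  proof (induction w arbitrary: f)
    case (Cons a w)
    have "ldel a (single [] :: 'a vec) = 0" "wgt q a (single []) = (single [] :: 'a vec)"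
      by (auto simp: ldel_def single_def wgt_def fun_eq_iff)
    with Cons show ?case by (simp add: star_Cons star_linear ldel_def)
  qed (simp add: star_Nil single_def)
  have 2: "star q f (single []) w = f w" for w
  proof (induction w arbitrary: f)
    case (Cons a w)
    have "ldel a (single [] :: 'a vec) = 0" by (auto simp: ldel_def single_def fun_eq_iff)
    with Cons show ?case by (simp add: star_Cons star_linear ldel_def)
  qed (simp add: star_Nil single_def)
  show "star q (single []) f = f" "star q f (single []) = f" using 1 2 by auto
qed

section \<open>Catalan weights\<close>

lemma psum_eq_lev: "i \<le> length w \<Longrightarrow> psum w i = lev (take i w)"
  by (induction i) (auto simp: psum_def take_Suc_conv_app_nth)

text \<open>The Catalan weight without the Catalan condition: a path that goes below level 0 meets the factor \<open>[0] = 0\<close>.\<close>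
definition pwt :: "'a::field \<Rightarrow> 'a vec" where
  "pwt q w = (\<Prod>i\<le>length w. qint q (1 + lev (take i w)))"

lemma pwt_snoc: "pwt q (w @ [a]) = pwt q w * qint q (1 + lev w + bar a)"
  by (simp add: pwt_def add.assoc)

locale generic_q =
  fixes q :: "'a::field_char_0"
  assumes q_nz: "q \<noteq> 0" and q_not_root: "0 < m \<Longrightarrow> q ^ m \<noteq> 1"
begin

abbreviation "d \<equiv> q - inverse q"

lemma d_nz: "d \<noteq> 0"
  using q_not_root[of 2] q_nz by (auto simp: power2_eq_square field_simps)

lemma d_qint: "d * qint q k = q powi k - q powi (- k)"
  using d_nz by (simp add: qint_def)

lemma qint_0 [simp]: "qint q 0 = 0" and qint_1 [simp]: "qint q 1 = 1"
  using d_nz by (auto simp: qint_def)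

lemma powi_double: "q powi (2 * k) = q powi k * q powi k"
  using power_int_add[OF disjI1, OF q_nz, of k k] by simp

text \<open>Identities between \<open>q\<close>-integers become rational identities once all powers of \<open>q\<close> are split off.\<close>
lemmas powi = power_int_add[OF disjI1, OF q_nz] power_int_diff[OF disjI1, OF q_nz]
  power_int_minus powi_double distrib_left right_diff_distrib

lemma pwt_Nil [simp]: "pwt q [] = 1"
  by (simp add: pwt_def)

lemma pwt_eq_0: "i \<le> length w \<Longrightarrow> lev (take i w) < 0 \<Longrightarrow> pwt q w = 0"
proof (induction w arbitrary: i rule: rev_induct)
  case (snoc a w)
  show ?case
  proof (cases "i \<le> length w \<or> lev w < 0")
    case True
    then have "pwt q w = 0" using snoc.IH[of i] snoc.IH[of "length w"] snoc.prems by auto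
    then show ?thesis by (simp add: pwt_snoc)
  next
    case False
    with snoc.prems have "i = Suc (length w)" by auto
    with snoc.prems False have "lev w = 0" "a = Y" by (cases a; auto)+
    then show ?thesis by (simp add: pwt_snoc)
  qed
qed simp

lemma pwt_neg: "lev w < 0 \<Longrightarrow> pwt q w = 0"
  using pwt_eq_0[of "length w" w] by simp

text \<open>A word of level 0 that is not Catalan has a negative prefix, where \<open>pwt\<close>
  vanishes. So \<open>C n\<close> is the component of \<open>pwt\<close> of length 2n and level
  0.\<close>

lemma Cat_eq: "Cat q n w = (if length w = 2 * n \<and> lev w = 0 then pwt q w else 0)"
proof -
  have "pwt q w = 0" if "lev w = 0" "\<not> catalan w"
  proof -
    from that obtain i where "i < length w" "psum w i < 0"
      by (auto simp: catalan_def psum_eq_lev not_le)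
    then show ?thesis using pwt_eq_0[of i w] by (simp add: psum_eq_lev)
  qed
  moreover have "lev w = 0" if "catalan w"
    using that by (simp add: catalan_def psum_eq_lev)
  moreover have "(\<Prod>i\<le>2 * n. qint q (1 + psum w i)) = pwt q w" if "length w = 2 * n"
    unfolding pwt_def using that by (intro prod.cong) (auto simp: psum_eq_lev)
  ultimately show ?thesis by (auto simp: Cat_def)
qed

section \<open>Identities of q-integers\<close>

lemma qint_eqI: "d * qint q k = d * r \<Longrightarrow> qint q k = r"
  using d_nz by simp

lemma qint_add_2: "qint q (k + 2) = qint q k + (q powi (k + 1) + q powi (- (k + 1)))"
proof (rule qint_eqI)
  have "d * (qint q k + (q powi (k + 1) + q powi (- (k + 1)))) = d * qint q k + d * (q powi (k + 1) + q powi (- (k + 1)))"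
    by (simp only: distrib_left)
  also have "\<dots> = d * qint q (k + 2)"
    unfolding d_qint using q_nz by (simp add: powi field_simps power2_eq_square)
  finally show "d * qint q (k + 2) = d * (qint q k + (q powi (k + 1) + q powi (- (k + 1))))" by (rule sym)
qed

lemma qint_double: "qint q (2 * k) = qint q k * (q powi k + q powi (- k))"
proof (rule qint_eqI)
  have "d * (qint q k * (q powi k + q powi (- k))) = d * qint q k * (q powi k + q powi (- k))"
    by (simp only: mult.assoc)
  also have "\<dots> = d * qint q (2 * k)"
    unfolding d_qint mult_minus_right[symmetric] powi_double by (simp add: algebra_simps)
  finally show "d * qint q (2 * k) = d * (qint q k * (q powi k + q powi (- k)))" by (rule sym)
qed

lemma qint_2: "qint q 2 = q + inverse q"
  using qint_double[of 1] by simp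

abbreviation shuffle (infixl "\<star>" 70) where "f \<star> g \<equiv> star q f g"

section \<open>Prefix recursions for products of \<open>pwt\<close> with \<open>x\<close> and
  \<open>xy\<close>\<close>

definition x :: "'a vec" where "x = single [X]"
definition y :: "'a vec" where "y = single [Y]"
definition xy :: "'a vec" where "xy = single [X, Y]"

lemma del_letters:
  "ldel X x = single []" "ldel Y x = 0" "ldel X y = 0" "ldel Y y = single []" "ldel X xy = y" "ldel Y xy = 0"
  "rdel X x = single []" "rdel Y x = 0" "rdel X y = 0" "rdel Y y = single []" "rdel Y xy = x" "rdel X xy = 0"
  by (auto simp: fun_eq_iff ldel_def rdel_def x_def y_def xy_def single_def)

lemma letters_Nil: "x [] = 0" "y [] = 0" "xy [] = 0"
  by (auto simp: x_def y_def xy_def single_def)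

lemma wgt_homogeneous:
  assumes "\<And>w. f w \<noteq> 0 \<Longrightarrow> lev w = k"
  shows "wgt q a f = vscale (q powi (2 * bar a * k)) f"
  using assms by (force simp: wgt_def fun_eq_iff)

lemma wgt_letters: "wgt q X x = vscale (q powi 2) x" "wgt q Y x = vscale (q powi -2) x"
  "wgt q X y = vscale (q powi -2) y" "wgt q Y y = vscale (q powi 2) y" "wgt q a xy = xy"
  by (auto simp: x_def y_def xy_def single_def wgt_def fun_eq_iff)

text \<open>As \<open>f\<close> has level \<open>k\<close>, the other factor only enters at level
  \<open>lev v - k\<close>, so a level-dependent scalar on it comes out as a constant.\<close>

lemma star_level:
  assumes "\<And>w. f w \<noteq> 0 \<Longrightarrow> lev w = k"
  shows "(f \<star> (\<lambda>w. h (lev w) * g w)) v = h (lev v - k) * (f \<star> g) v"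
    "((\<lambda>w. h (lev w) * g w) \<star> f) v = h (lev v - k) * (g \<star> f) v"
proof -
  have "(f \<star> (\<lambda>w. h (lev w) * g w)) v = (f \<star> vscale (h (lev v - k)) g) v"
    by (rule star_cong) (use assms in force)
  then show "(f \<star> (\<lambda>w. h (lev w) * g w)) v = h (lev v - k) * (f \<star> g) v" by (simp add: star_linear)
  have "((\<lambda>w. h (lev w) * g w) \<star> f) v = (vscale (h (lev v - k)) g \<star> f) v"
    by (rule star_cong) (use assms in force)
  then show "((\<lambda>w. h (lev w) * g w) \<star> f) v = h (lev v - k) * (g \<star> f) v" by (simp add: star_linear)
qed

lemma lev_letters: "x w \<noteq> 0 \<Longrightarrow> lev w = 1" "y w \<noteq> 0 \<Longrightarrow> lev w = -1" "xy w \<noteq> 0 \<Longrightarrow> lev w = 0"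
  by (auto simp: x_def y_def xy_def single_def split: if_splits)

lemma rdel_pwt: "rdel a (pwt q) = (\<lambda>w. qint q (1 + lev w + bar a) * pwt q w)"
  by (auto simp: rdel_def pwt_snoc fun_eq_iff)

text \<open>\<open>pwt\<close> has infinite support, but each coefficient of a product is a finite
  sum. Working with \<open>pwt\<close> treats all \<open>C n\<close> at once and allows induction on
  prefixes, whose levels are arbitrary.\<close>

abbreviation "S \<equiv> x \<star> pwt q"
abbreviation "S' \<equiv> pwt q \<star> x"

lemma S_snoc:
  "S (w @ [X]) = qint q (lev w + 1) * S w + q powi (2 * lev w) * pwt q w"
  "S (w @ [Y]) = qint q (lev w - 1) * S w"
  "S' (w @ [X]) = pwt q w + q powi 2 * qint q (lev w + 1) * S' w"
  "S' (w @ [Y]) = q powi (-2) * qint q (lev w - 1) * S' w"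
proof -
  note lx = star_level[of x 1, OF lev_letters(1)]
  have e: "1 + (lev w - 1) + 1 = lev w + 1" "1 + (lev w - 1) + - 1 = lev w - 1" by auto
  show "S (w @ [X]) = qint q (lev w + 1) * S w + q powi (2 * lev w) * pwt q w"
    using fun_cong[OF rdel_star[OF q_nz, of X x "pwt q"], of w]
      lx(1)[of "\<lambda>k. qint q (1 + k + 1)" "pwt q" w]
    by (simp add: rdel_apply rdel_pwt del_letters star_linear wgt_def e)
  show "S (w @ [Y]) = qint q (lev w - 1) * S w"
    using fun_cong[OF rdel_star[OF q_nz, of Y x "pwt q"], of w]
      lx(1)[of "\<lambda>k. qint q (1 + k + - 1)" "pwt q" w]
    by (simp add: rdel_apply rdel_pwt del_letters star_linear wgt_def)
  show "S' (w @ [X]) = pwt q w + q powi 2 * qint q (lev w + 1) * S' w"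
    using fun_cong[OF rdel_star[OF q_nz, of X "pwt q" x], of w]
      lx(2)[of "\<lambda>k. qint q (1 + k + 1)" "pwt q" w]
    by (simp add: rdel_apply rdel_pwt del_letters star_linear wgt_letters e)
  show "S' (w @ [Y]) = q powi (-2) * qint q (lev w - 1) * S' w"
    using fun_cong[OF rdel_star[OF q_nz, of Y "pwt q" x], of w]
      lx(2)[of "\<lambda>k. qint q (1 + k + - 1)" "pwt q" w]
    by (simp add: rdel_apply rdel_pwt del_letters star_linear wgt_letters)
qed

text \<open>If \<open>v\<close> ends in \<open>X\<close>, its prefix has level -1, which gives a
  factor [0] and a vanishing \<open>pwt\<close>; if it ends in \<open>Y\<close>, the prefix has
  level 1 and the factor is [0].\<close>

lemma S_level_0: "lev v = 0 \<Longrightarrow> S v = 0"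
proof (cases v rule: rev_cases)
  case (snoc w a)
  assume "lev v = 0"
  with snoc show ?thesis by (cases a) (auto simp: S_snoc pwt_neg)
qed (simp add: star_Nil letters_Nil)

text \<open>Only level 1 is used for \<open>x_Yc\<close>; the induction needs all levels, and the
  power of q before \<open>S'\<close> makes both products obey the same recursion. Appending
  \<open>X\<close> reduces to [l+1][l] + [2l+2] = [l+1][l+2].\<close>

lemma S_S':
  "q powi 2 * S v - q powi (- 2 * lev v) * S' v = d * qint q (lev v) * pwt q v"
proof (induction v rule: rev_induct)
  case Nil
  show ?case by (simp add: star_Nil letters_Nil)
next
  case (snoc a w)
  show ?case
  proof (cases a)
    case X
    have "q powi 2 * S (w @ [X]) - q powi (- 2 * (lev w + 1)) * S' (w @ [X])
       = qint q (lev w + 1) * (q powi 2 * S w - q powi (- 2 * lev w) * S' w)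
         + (q powi (2 * (lev w + 1)) - q powi (- (2 * (lev w + 1)))) * pwt q w"
      using q_nz by (simp add: S_snoc powi field_simps)
    also have "\<dots> = d * (qint q (lev w + 1) * qint q (lev w) + qint q (2 * (lev w + 1))) * pwt q w"
      unfolding snoc.IH by (simp only: d_qint[symmetric]) (simp add: algebra_simps)
    also have "qint q (lev w + 1) * qint q (lev w) + qint q (2 * (lev w + 1)) = qint q (lev w + 1) * qint q (lev w + 2)"
    proof -
      show ?thesis unfolding qint_double qint_add_2 by (simp add: algebra_simps)
    qed
    finally show ?thesis by (simp add: X pwt_snoc ac_simps)
  next
    case Y
    have "q powi 2 * S (w @ [Y]) - q powi (- 2 * (lev w - 1)) * S' (w @ [Y])
       = qint q (lev w - 1) * (q powi 2 * S w - q powi (- 2 * lev w) * S' w)"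
      using q_nz by (simp add: S_snoc powi field_simps)
    then show ?thesis unfolding snoc.IH by (simp add: Y pwt_snoc ac_simps)
  qed
qed

lemma xy_pwt_snoc:
  "(xy \<star> pwt q) (w @ [X]) = qint q (lev w + 2) * (xy \<star> pwt q) w"
  "(xy \<star> pwt q) (w @ [Y]) = qint q (lev w) * (xy \<star> pwt q) w + q powi (2 - 2 * lev w) * S w"
  "(pwt q \<star> xy) (w @ [X]) = qint q (lev w + 2) * (pwt q \<star> xy) w"
  "(pwt q \<star> xy) (w @ [Y]) = S' w + qint q (lev w) * (pwt q \<star> xy) w"
proof -
  note lx = star_level[of x 1, OF lev_letters(1)]
  note lxy = star_level[of xy 0, OF lev_letters(3)]
  have e: "1 + lev w + 1 = lev w + 2" by auto
  show "(xy \<star> pwt q) (w @ [X]) = qint q (lev w + 2) * (xy \<star> pwt q) w"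
    using fun_cong[OF rdel_star[OF q_nz, of X xy "pwt q"], of w]
      lxy(1)[of "\<lambda>k. qint q (1 + k + 1)" "pwt q" w]
    by (simp add: rdel_apply rdel_pwt del_letters star_linear e)
  show "(xy \<star> pwt q) (w @ [Y]) = qint q (lev w) * (xy \<star> pwt q) w + q powi (2 - 2 * lev w) * S w"
    using fun_cong[OF rdel_star[OF q_nz, of Y xy "pwt q"], of w]
      lxy(1)[of "\<lambda>k. qint q (1 + k + - 1)" "pwt q" w] lx(1)[of "\<lambda>k. q powi (- 2 * k)" "pwt q" w]
    by (simp add: rdel_apply rdel_pwt del_letters star_linear wgt_def algebra_simps)
  show "(pwt q \<star> xy) (w @ [X]) = qint q (lev w + 2) * (pwt q \<star> xy) w"
    using fun_cong[OF rdel_star[OF q_nz, of X "pwt q" xy], of w]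
      lxy(2)[of "\<lambda>k. qint q (1 + k + 1)" "pwt q" w]
    by (simp add: rdel_apply rdel_pwt del_letters star_linear wgt_letters e)
  show "(pwt q \<star> xy) (w @ [Y]) = S' w + qint q (lev w) * (pwt q \<star> xy) w"
    using fun_cong[OF rdel_star[OF q_nz, of Y "pwt q" xy], of w]
      lxy(2)[of "\<lambda>k. qint q (1 + k + - 1)" "pwt q" w]
    by (simp add: rdel_apply rdel_pwt del_letters star_linear wgt_letters)
qed

text \<open>The right side is the correction that closes the induction at every level; at level 0 it
  vanishes by \<open>S_level_0\<close>.\<close>

lemma xy_pwt_commutator:
  "(xy \<star> pwt q) v - (pwt q \<star> xy) v
     = q * (1 - q powi (2 * lev v)) * pwt q v + d * q powi 2 * qint q (lev v + 1) * S v"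
proof (induction v rule: rev_induct)
  case Nil
  show ?case by (simp add: star_Nil letters_Nil)
next
  case (snoc a w)
  let ?Z = "(xy \<star> pwt q) w - (pwt q \<star> xy) w"
  show ?case
  proof (cases a)
    case X
    have "(xy \<star> pwt q) (w @ [X]) - (pwt q \<star> xy) (w @ [X]) = qint q (lev w + 2) * ?Z"
      by (simp add: xy_pwt_snoc algebra_simps)
    then show ?thesis unfolding snoc.IH using q_nz
      by (simp add: X S_snoc pwt_snoc powi field_simps power2_eq_square)
  next
    case Y
    \<comment> \<open>The claim involves only \<open>S\<close> and \<open>pwt\<close>, so
      \<open>S'\<close> is eliminated by \<open>S_S'\<close>; \<open>dd\<close> then compares the
      coefficients of \<open>S w\<close>.\<close>
    have S': "S' w = q powi (2 * lev w) * (q powi 2 * S w - d * qint q (lev w) * pwt q w)"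
      using S_S'[of w] q_nz by (simp add: powi field_simps)
    have dd: "qint q (lev w + 1) * d * q powi 2 * qint q (lev w)
        + (q powi (2 - 2 * lev w) - q powi (2 * lev w + 2)) = d * q powi 2 * (qint q (lev w) * qint q (lev w - 1))"
    proof -
      have 1: "qint q (2 * lev w) = qint q (lev w) * (qint q (lev w + 1) - qint q (lev w - 1))"
        using qint_add_2[of "lev w - 1"] by (simp add: qint_double add.commute)
      have 2: "q powi (2 - 2 * lev w) - q powi (2 * lev w + 2) = - (q powi 2 * (d * qint q (2 * lev w)))"
        unfolding d_qint using q_nz by (simp add: powi field_simps)
      show ?thesis unfolding 2 1 by (simp add: algebra_simps)
    qed
    have "(xy \<star> pwt q) (w @ [Y]) - (pwt q \<star> xy) (w @ [Y])
        = qint q (lev w) * ?Z + q powi (2 - 2 * lev w) * S w - S' w"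
      by (simp add: xy_pwt_snoc algebra_simps)
    also have "\<dots> = (qint q (lev w + 1) * d * q powi 2 * qint q (lev w)
        + (q powi (2 - 2 * lev w) - q powi (2 * lev w + 2))) * S w
        + (q * (1 - q powi (2 * lev w)) + d * q powi (2 * lev w)) * qint q (lev w) * pwt q w"
      unfolding snoc.IH S' using q_nz by (simp add: powi algebra_simps)
    also have "q * (1 - q powi (2 * lev w)) + d * q powi (2 * lev w) = q * (1 - q powi (2 * (lev w - 1)))"
      using q_nz by (simp add: powi field_simps power2_eq_square)
    finally show ?thesis unfolding dd by (simp add: Y S_snoc pwt_snoc ac_simps)
  qed
qed

end

section \<open>Commutation relations\<close>

lemma conc_Nil: "conc f g [] = f [] * g []"
  by (simp add: conc_def)

lemma ldel_conc: "ldel a (conc f g) = vscale (f []) (ldel a g) + conc (ldel a f) g"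
  by (auto simp: fun_eq_iff ldel_def conc_def sum.atMost_Suc_shift simp del: sum.atMost_Suc)

lemma rdel_conc: "rdel a (conc f g) = conc f (rdel a g) + vscale (g []) (rdel a f)"
  by (auto simp: fun_eq_iff rdel_def conc_def)

lemma conc_zero: "conc (0 :: 'a::comm_ring_1 vec) g = 0" "conc f (0 :: 'a::comm_ring_1 vec) = 0"
  by (auto simp: fun_eq_iff conc_def)

lemma conc_one: "conc (single []) f = f" "conc f (single []) = (f :: 'a::field vec)"
proof -
  have d: "ldel a (single [] :: 'a vec) = 0" "rdel a (single [] :: 'a vec) = 0" for a
    by (auto simp: fun_eq_iff ldel_def rdel_def single_def)
  have one: "single [] [] = (1 :: 'a)" by (simp add: single_def)
  show "conc (single []) f = f"
    by (rule vec_eqI_left) (auto simp: conc_Nil ldel_conc d conc_zero one fun_eq_iff)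
  show "conc f (single []) = f"
    by (rule vec_eqI_right) (auto simp: conc_Nil rdel_conc d conc_zero one fun_eq_iff)
qed

lemma conc_nonzeroE:
  assumes "conc f g w \<noteq> 0"
  obtains u v where "w = u @ v" "f u \<noteq> 0" "g v \<noteq> 0"
proof -
  from assms obtain i where "f (take i w) * g (drop i w) \<noteq> 0"
    unfolding conc_def by (meson sum.not_neutral_contains_not_neutral)
  then have "f (take i w) \<noteq> 0" "g (drop i w) \<noteq> 0" by auto
  then show thesis using that[of "take i w" "drop i w"] by simp
qed

text \<open>Both sides run over the pairs with \<open>k + j + 1 < n\<close>, a condition symmetric
  in \<open>k\<close> and \<open>j\<close>.\<close>

lemma sum_triangle_swap:
  fixes F :: "nat \<Rightarrow> nat \<Rightarrow> 'b::comm_monoid_add"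
  shows "(\<Sum>k<n. \<Sum>j<n - 1 - k. F k j) = (\<Sum>j<n. \<Sum>k<n - 1 - j. F k j)"
proof -
  have "(\<Sum>k<n. \<Sum>j<n - 1 - k. F k j) = (\<Sum>(k, j)\<in>(SIGMA k:{..<n}. {..<n - 1 - k}). F k j)"
    by (rule sum.Sigma) auto
  also have "\<dots> = (\<Sum>(j, k)\<in>(SIGMA j:{..<n}. {..<n - 1 - j}). F k j)"
    by (rule sum.reindex_bij_witness[of _ prod.swap prod.swap]) auto
  also have "\<dots> = (\<Sum>j<n. \<Sum>k<n - 1 - j. F k j)"
    by (rule sum.Sigma[symmetric]) auto
  finally show ?thesis .
qed

text \<open>Pairs are sorted by \<open>m = k + j + 1\<close>, the index that \<open>comm_H\<close>
  produces.\<close>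

lemma sum_triangle_diagonal:
  fixes F :: "nat \<Rightarrow> nat \<Rightarrow> 'b::comm_monoid_add"
  shows "(\<Sum>k<n. \<Sum>j<n - 1 - k. F k j) = (\<Sum>m<n. \<Sum>k<m. F k (m - 1 - k))"
proof -
  have "(\<Sum>k<n. \<Sum>j<n - 1 - k. F k j) = (\<Sum>(k, j)\<in>(SIGMA k:{..<n}. {..<n - 1 - k}). F k j)"
    by (rule sum.Sigma) auto
  also have "\<dots> = (\<Sum>(m, k)\<in>(SIGMA m:{..<n}. {..<m}). F k (m - 1 - k))"
    by (rule sum.reindex_bij_witness[of _ "\<lambda>(m, k). (k, m - 1 - k)" "\<lambda>(k, j). (k + j + 1, k)"]) auto
  also have "\<dots> = (\<Sum>m<n. \<Sum>k<m. F k (m - 1 - k))"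
    by (rule sum.Sigma[symmetric]) auto
  finally show ?thesis .
qed

interpretation vec: vector_space "vscale :: 'a::field \<Rightarrow> 'a vec \<Rightarrow> 'a vec"
  by unfold_locales (auto simp: fun_eq_iff algebra_simps)

text \<open>Induction and calculational reasoning leave eta-expanded equations between vectors, which the simplifier would
  turn into \<open>\<lambda>\<close>-terms if it evaluated the vector operations under the binder.\<close>
declare plus_fun_apply [simp del] minus_apply [simp del] uminus_apply [simp del] zero_fun_apply [simp del] vscale_apply [simp del]

lemmas pointwise = plus_fun_apply minus_apply uminus_apply zero_fun_apply vscale_apply

section \<open>The families \<open>Xc\<close>, \<open>Yc\<close> and \<open>H\<close>\<close>

context generic_q begin

abbreviation "C \<equiv> Cat q"
definition "Xc n = conc x (C n)"
definition "Yc n = conc (C n) y"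
definition "H n = conc (Xc n) y"

lemma C_0: "C 0 = single []"
  by (auto simp: Cat_eq single_def fun_eq_iff)

lemma at_Nil: "C n [] = (if n = 0 then 1 else 0)" "Xc n [] = 0" "Yc n [] = 0" "H n [] = 0"
  by (auto simp: Cat_eq Xc_def Yc_def H_def conc_Nil letters_Nil)

lemma Yc_0: "Yc 0 = y"
  by (simp add: Yc_def C_0 conc_one)

text \<open>Nonempty Catalan words begin with \<open>X\<close> and end with
  \<open>Y\<close>.\<close>

lemma ldel_C: "ldel Y (C n) = 0" and rdel_C: "rdel X (C n) = 0"
proof -
  have "pwt q (Y # w) = 0" for w using pwt_eq_0[of 1 "Y # w"] by simp
  then show "ldel Y (C n) = 0" by (auto simp: fun_eq_iff pointwise ldel_def Cat_eq)
  have "pwt q w = 0" if "lev w + 1 = 0" for w using pwt_neg[of w] that by simp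
  then show "rdel X (C n) = 0" by (auto simp: fun_eq_iff pointwise rdel_def Cat_eq pwt_snoc)
qed

lemma ldel_elems: "ldel X (Xc n) = C n" "ldel Y (Xc n) = 0" "ldel X (H n) = Yc n" "ldel Y (H n) = 0"
  by (auto simp: Xc_def H_def Yc_def ldel_conc del_letters letters_Nil conc_one conc_zero conc_Nil)

lemma rdel_elems: "rdel Y (Yc n) = C n" "rdel X (Yc n) = 0" "rdel Y (H n) = Xc n" "rdel X (H n) = 0"
  by (auto simp: Xc_def H_def Yc_def rdel_conc del_letters letters_Nil conc_one conc_zero conc_Nil)

lemma lev_elems: "C n w \<noteq> 0 \<Longrightarrow> lev w = 0" "Xc n w \<noteq> 0 \<Longrightarrow> lev w = 1"
  "Yc n w \<noteq> 0 \<Longrightarrow> lev w = -1" "H n w \<noteq> 0 \<Longrightarrow> lev w = 0"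
proof -
  show C: "C n w \<noteq> 0 \<Longrightarrow> lev w = 0" for w by (auto simp: Cat_eq split: if_splits)
  show X: "Xc n w \<noteq> 0 \<Longrightarrow> lev w = 1" for w
    unfolding Xc_def by (erule conc_nonzeroE) (simp add: C lev_letters)
  show "Yc n w \<noteq> 0 \<Longrightarrow> lev w = -1"
    unfolding Yc_def by (erule conc_nonzeroE) (simp add: C lev_letters)
  show "H n w \<noteq> 0 \<Longrightarrow> lev w = 0"
    unfolding H_def by (erule conc_nonzeroE) (simp add: X lev_letters)
qed

lemma wgt_elems: "wgt q a (C n) = C n" "wgt q a (H n) = H n" "wgt q Y (Yc n) = vscale (q\<^sup>2) (Yc n)"
  "wgt q X (Xc n) = vscale (q\<^sup>2) (Xc n)" "wgt q X (Yc n) = vscale (inverse (q\<^sup>2)) (Yc n)"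
  by (simp_all add: wgt_homogeneous[OF lev_elems(1)] wgt_homogeneous[OF lev_elems(2)]
    wgt_homogeneous[OF lev_elems(3)] wgt_homogeneous[OF lev_elems(4)] power_int_minus)

lemma wgt_letters': "wgt q X x = vscale (q\<^sup>2) x" "wgt q Y x = vscale (inverse (q\<^sup>2)) x"
  "wgt q X y = vscale (inverse (q\<^sup>2)) y" "wgt q Y y = vscale (q\<^sup>2) y"
  by (simp_all add: wgt_letters power_int_minus)

text \<open>Transfers the coefficient identities for \<open>pwt\<close> to \<open>C n\<close>: a
  bihomogeneous factor sees only one component of \<open>pwt\<close> in each bidegree.\<close>

lemma star_Cat:
  assumes "\<And>w. f w \<noteq> 0 \<Longrightarrow> length w = l \<and> lev w = k"
  shows "(f \<star> C n) v = (if length v = 2 * n + l \<and> lev v = k then (f \<star> pwt q) v else 0)"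
    and "(C n \<star> f) v = (if length v = 2 * n + l \<and> lev v = k then (pwt q \<star> f) v else 0)"
proof -
  have "(f \<star> C n) v = (f \<star> pwt q) v" if "length v = 2 * n + l" "lev v = k"
    by (rule star_cong) (use assms that in \<open>force simp: Cat_eq\<close>)
  moreover have "(C n \<star> f) v = (pwt q \<star> f) v" if "length v = 2 * n + l" "lev v = k"
    by (rule star_cong) (use assms that in \<open>force simp: Cat_eq\<close>)
  \<comment> \<open>Off the bidegree every contributing product of coefficients is zero; comparing
    with \<open>0 \<star> 0\<close> expresses this through \<open>star_cong\<close>.\<close>
  moreover have "(f \<star> C n) v = (0 \<star> 0) v" if "\<not> (length v = 2 * n + l \<and> lev v = k)"
    by (rule star_cong) (use assms that in \<open>force simp: Cat_eq pointwise\<close>)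
  moreover have "(C n \<star> f) v = (0 \<star> 0) v" if "\<not> (length v = 2 * n + l \<and> lev v = k)"
    by (rule star_cong) (use assms that in \<open>force simp: Cat_eq pointwise\<close>)
  ultimately show "(f \<star> C n) v = (if length v = 2 * n + l \<and> lev v = k then (f \<star> pwt q) v else 0)"
    and "(C n \<star> f) v = (if length v = 2 * n + l \<and> lev v = k then (pwt q \<star> f) v else 0)"
    by (auto simp: star_linear pointwise)
qed

text \<open>The coefficient q^2 makes the deletion of a last \<open>X\<close> cancel; deletion of a
  last \<open>Y\<close> leaves \<open>S_S'\<close> at level 1.\<close>

lemma x_Yc: "vscale (q\<^sup>2) (x \<star> Yc n) - Yc n \<star> x = vscale d (C (Suc n))"
proof (rule vec_eqI_right)
  show "(vscale (q\<^sup>2) (x \<star> Yc n) - Yc n \<star> x) [] = vscale d (C (Suc n)) []"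
    by (simp add: star_Nil at_Nil pointwise)
  show "rdel X (vscale (q\<^sup>2) (x \<star> Yc n) - Yc n \<star> x) = rdel X (vscale d (C (Suc n)))"
    using q_nz by (simp add: rdel_linear rdel_star rdel_C rdel_elems del_letters star_linear
      wgt_homogeneous[OF lev_elems(3)] power_int_minus)
  have "rdel Y (vscale (q\<^sup>2) (x \<star> Yc n) - Yc n \<star> x) = vscale (q\<^sup>2) (x \<star> C n) - vscale (inverse (q\<^sup>2)) (C n \<star> x)"
    using q_nz by (simp add: rdel_linear rdel_star rdel_elems del_letters star_linear wgt_letters')
  also have "\<dots> = rdel Y (vscale d (C (Suc n)))"
  proof (rule ext)
    fix v
    have x1: "length w = 1 \<and> lev w = 1" if "x w \<noteq> 0" for w
      using that by (auto simp: x_def single_def split: if_splits)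
    have "q\<^sup>2 * S v - inverse (q\<^sup>2) * S' v = d * pwt q v" if "lev v = 1"
      using S_S'[of v] that by (simp add: power_int_minus)
    then show "(vscale (q\<^sup>2) (x \<star> C n) - vscale (inverse (q\<^sup>2)) (C n \<star> x)) v = rdel Y (vscale d (C (Suc n))) v"
      using star_Cat[of x 1 1, OF x1, where n = n and v = v]
      by (auto simp: rdel_def Cat_eq pwt_snoc pointwise)
  qed
  finally show "rdel Y (vscale (q\<^sup>2) (x \<star> Yc n) - Yc n \<star> x) = rdel Y (vscale d (C (Suc n)))" .
qed

section \<open>Commutators with \<open>xy\<close>\<close>

definition comm :: "'a vec \<Rightarrow> 'a vec \<Rightarrow> 'a vec" where "comm f g = f \<star> g - g \<star> f"

lemma comm_star: "comm f (g \<star> h) = comm f g \<star> h + g \<star> comm f h"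
  by (simp add: comm_def star_linear star_assoc[OF q_nz])

lemma comm_linear: "comm f (vscale s g) = vscale s (comm f g)" "comm f (g - h) = comm f g - comm f h"
  "comm f (\<Sum>i\<in>I. k i) = (\<Sum>i\<in>I. comm f (k i))"
  by (simp_all add: comm_def star_linear star_sum vec.scale_right_diff_distrib sum_subtractf)

lemma comm_xy_C: "comm xy (C n) = 0"
proof (rule ext)
  fix v
  have xy2: "length w = 2 \<and> lev w = 0" if "xy w \<noteq> 0" for w
    using that by (auto simp: xy_def single_def split: if_splits)
  show "comm xy (C n) v = 0 v"
    using star_Cat[of xy 2 0, OF xy2, where n = n and v = v] xy_pwt_commutator[of v] S_level_0[of v]
    by (cases "lev v = 0") (simp_all add: comm_def pointwise)
qed

text \<open>Deleting the last \<open>Y\<close> leaves \<open>x_Yc\<close> and the vanishing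
  commutator with \<open>C n\<close>. Up to a scalar this is the image of the recursion in
  \<open>Ea1\<close>.\<close>

lemma comm_xy_Yc: "comm xy (Yc n) = vscale d (Yc (Suc n))"
proof (rule vec_eqI_right)
  show "comm xy (Yc n) [] = vscale d (Yc (Suc n)) []"
    by (simp add: comm_def star_Nil at_Nil pointwise)
  show "rdel X (comm xy (Yc n)) = rdel X (vscale d (Yc (Suc n)))"
    by (simp add: comm_def rdel_linear rdel_star[OF q_nz] rdel_elems del_letters star_linear)
  have "rdel Y (comm xy (Yc n)) = vscale (q\<^sup>2) (x \<star> Yc n) - Yc n \<star> x + comm xy (C n)"
    by (simp add: comm_def rdel_linear rdel_star[OF q_nz] rdel_elems del_letters star_linear wgt_elems wgt_letters)
  then show "rdel Y (comm xy (Yc n)) = rdel Y (vscale d (Yc (Suc n)))"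
    by (simp add: x_Yc comm_xy_C rdel_linear rdel_elems)
qed

text \<open>Mirror image of \<open>comm_xy_Yc\<close>. It is conditional because its hypothesis, the
  case \<open>Yc 0 = y\<close> of \<open>Xc_Yc\<close>, becomes available only inside the induction
  there.\<close>

lemma comm_xy_Xc_if:
  assumes "vscale (q\<^sup>2) (Xc n \<star> y) - y \<star> Xc n = vscale d (C (Suc n))"
  shows "comm xy (Xc n) = - vscale d (Xc (Suc n))"
proof (rule vec_eqI_left)
  show "comm xy (Xc n) [] = (- vscale d (Xc (Suc n))) []"
    by (simp add: comm_def star_Nil at_Nil pointwise)
  show "ldel Y (comm xy (Xc n)) = ldel Y (- vscale d (Xc (Suc n)))"
    by (simp add: comm_def ldel_linear ldel_star ldel_elems del_letters star_linear)
  have "ldel X (comm xy (Xc n)) = - (vscale (q\<^sup>2) (Xc n \<star> y) - y \<star> Xc n) + comm xy (C n)"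
    by (simp add: comm_def ldel_linear ldel_star ldel_elems del_letters star_linear wgt_elems wgt_letters)
  then show "ldel X (comm xy (Xc n)) = ldel X (- vscale d (Xc (Suc n)))"
    by (simp add: assms comm_xy_C ldel_linear ldel_elems)
qed

lemma vscale_d_cancel: "vscale d f = vscale d g \<Longrightarrow> f = g"
  using d_nz by simp

text \<open>Taking the commutator with \<open>xy\<close> moves one index from \<open>Yc\<close> to \<open>Xc\<close>, so everything follows from \<open>k = 0\<close>.\<close>
lemma Xc_Yc: "vscale (q\<^sup>2) (Xc k \<star> Yc n) - Yc n \<star> Xc k = vscale d (C (Suc (k + n)))"
proof (induction k arbitrary: n)
  case 0
  show ?case using x_Yc[of n] by (simp add: Xc_def C_0 conc_one)
next
  case (Suc k)
  have X: "comm xy (Xc k) = - vscale d (Xc (Suc k))"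
    by (rule comm_xy_Xc_if) (use Suc[of 0] in \<open>simp add: Yc_0\<close>)
  have "vscale d (vscale (q\<^sup>2) (Xc (Suc k) \<star> Yc n) - Yc n \<star> Xc (Suc k))
     = vscale d (vscale (q\<^sup>2) (Xc k \<star> Yc (Suc n)) - Yc (Suc n) \<star> Xc k)
       - comm xy (vscale (q\<^sup>2) (Xc k \<star> Yc n) - Yc n \<star> Xc k)"
    by (simp add: comm_linear comm_star X comm_xy_Yc star_linear fun_eq_iff pointwise algebra_simps)
  also have "\<dots> = vscale d (vscale d (C (Suc (k + Suc n))))"
    unfolding Suc by (simp add: comm_linear comm_xy_C)
  also have "\<dots> = vscale d (vscale d (C (Suc (Suc k + n))))" by simp
  finally show ?case by (rule vscale_d_cancel)
qed

section \<open>Deletion of the first letter from \<open>C n\<close>\<close>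

lemma d_ldel_C: "vscale d (ldel X (C (Suc n))) = vscale (q\<^sup>2) (C n \<star> y) - vscale (inverse (q\<^sup>2)) (y \<star> C n)"
proof -
  have "vscale d (ldel X (C (Suc n))) = ldel X (vscale (q\<^sup>2) (Xc n \<star> y) - y \<star> Xc n)"
    using Xc_Yc[of n 0] by (simp add: Yc_0 ldel_linear)
  then show ?thesis
    by (simp add: ldel_linear ldel_star ldel_elems del_letters star_linear wgt_letters')
qed

text \<open>The convolution \<open>Q 0\<close> turns out to be \<open>ldel X (C n)\<close> up to the factor \<open>[2]\<close>; the shift \<open>j\<close> records
  iterated commutators with \<open>xy\<close>.\<close>
definition "Q j n = (\<Sum>k<n. vscale (q ^ (2 * k)) (Yc (k + j) \<star> C (n - 1 - k)))"

lemma Q_Suc: "Q 0 (Suc n) = y \<star> C n + vscale (q\<^sup>2) (Q 1 n)"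
  unfolding Q_def by (simp add: sum.lessThan_Suc_shift Yc_0 vec.scale_sum_right power_add power2_eq_square mult.assoc
     del: sum.lessThan_Suc)

lemma comm_xy_Q: "comm xy (Q j n) = vscale d (Q (Suc j) n)"
  unfolding Q_def by (simp add: comm_linear comm_star comm_xy_Yc comm_xy_C star_linear vec.scale_sum_right mult.commute)

text \<open>Obtained by deleting the first \<open>X\<close> from the vanishing commutator of
  \<open>xy\<close> with \<open>C n\<close>.\<close>

lemma comm_C_y: "comm (C n) y = comm xy (ldel X (C n))"
proof -
  have "ldel X (comm xy (C n)) = comm xy (ldel X (C n)) - comm (C n) y"
    by (simp add: comm_def ldel_linear ldel_star ldel_elems del_letters star_linear wgt_elems wgt_letters)
  then show ?thesis by (simp add: comm_xy_C ldel_linear)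
qed

text \<open>The formula for \<open>n\<close> determines the commutator of \<open>C n\<close> with \<open>y\<close>, and that commutator gives the formula for
  \<open>n + 1\<close>.\<close>
lemma ldel_C_eq_Q: "ldel X (C n) = vscale (qint q 2) (Q 0 n)"
proof (induction n)
  case 0
  show ?case by (auto simp: C_0 Q_def fun_eq_iff pointwise ldel_def single_def)
next
  case (Suc n)
  have "vscale d (ldel X (C (Suc n))) = vscale (q\<^sup>2) (C n \<star> y) - vscale (inverse (q\<^sup>2)) (y \<star> C n)"
    by (rule d_ldel_C)
  also have "\<dots> = vscale (q\<^sup>2 - inverse (q\<^sup>2)) (y \<star> C n) + vscale (q\<^sup>2) (comm (C n) y)"
    by (simp add: comm_def fun_eq_iff pointwise algebra_simps)
  also have "q\<^sup>2 - inverse (q\<^sup>2) = d * qint q 2"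
    by (simp add: d_qint power_int_minus)
  also have "comm (C n) y = vscale (d * qint q 2) (Q 1 n)"
    unfolding comm_C_y Suc.IH by (simp add: comm_linear comm_xy_Q mult.commute)
  finally have "vscale d (ldel X (C (Suc n))) = vscale d (vscale (qint q 2) (Q 0 (Suc n)))"
    by (simp add: Q_Suc vec.scale_right_distrib ac_simps)
  then show ?case by (rule vscale_d_cancel)
qed

text \<open>Commutation with \<open>xy\<close> annihilates \<open>C n\<close> and raises the index
  of \<open>Yc\<close> and of \<open>Q\<close>, so the case \<open>j = 0\<close> propagates.\<close>

lemma comm_C_Yc: "comm (C n) (Yc j) = vscale (d * qint q 2) (Q (Suc j) n)"
proof (induction j)
  case 0
  show ?case unfolding Yc_0 comm_C_y ldel_C_eq_Q by (simp add: comm_linear comm_xy_Q mult.commute)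
next
  case (Suc j)
  have "vscale d (comm (C n) (Yc (Suc j))) = comm xy (comm (C n) (Yc j))"
    by (simp add: comm_def[of "C n"] comm_linear comm_star comm_xy_C comm_xy_Yc star_linear vec.scale_right_diff_distrib)
  also have "\<dots> = vscale d (vscale (d * qint q 2) (Q (Suc (Suc j)) n))"
    unfolding Suc.IH by (simp add: comm_linear comm_xy_Q mult.commute)
  finally show ?case by (rule vscale_d_cancel)
qed

text \<open>Deleting the last \<open>Y\<close> reduces the second commutator at \<open>n\<close> to the first, and deleting the first \<open>X\<close> reduces
  the first commutator at \<open>n\<close> to both commutators at smaller indices.\<close>
lemma comm_H: "comm (H k) (C n) = 0 \<and> comm (H k) (Yc n) = vscale d (Yc (n + k + 1))"
proof (induction n arbitrary: k rule: less_induct)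
  case (less n)
  have C: "comm (H k) (C n) = 0"
  proof (rule vec_eqI_left)
    have "comm (H k) (Q 0 n) = vscale d (Q (Suc k) n)"
      unfolding Q_def using less
      by (auto simp: comm_linear comm_star star_linear vec.scale_sum_right mult.commute intro!: sum.cong)
    moreover have "ldel X (comm (H k) (C n)) = comm (H k) (ldel X (C n)) - comm (C n) (Yc k)"
      by (simp add: comm_def ldel_linear ldel_star ldel_elems wgt_elems)
    ultimately show "ldel X (comm (H k) (C n)) = ldel X 0"
      by (simp add: ldel_C_eq_Q comm_C_Yc comm_linear ldel_linear mult.commute)
  qed (simp_all add: comm_def star_Nil at_Nil pointwise ldel_linear ldel_star ldel_elems ldel_C star_linear)
  have "comm (H k) (Yc n) = vscale d (Yc (n + k + 1))"
  proof (rule vec_eqI_right)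
    have "rdel Y (comm (H k) (Yc n)) = comm (H k) (C n) + (vscale (q\<^sup>2) (Xc k \<star> Yc n) - Yc n \<star> Xc k)"
      by (simp add: comm_def rdel_linear rdel_star[OF q_nz] rdel_elems wgt_elems star_linear)
    then show "rdel Y (comm (H k) (Yc n)) = rdel Y (vscale d (Yc (n + k + 1)))"
      by (simp add: C Xc_Yc rdel_linear rdel_elems add.commute)
  qed (simp_all add: comm_def star_Nil at_Nil pointwise rdel_linear rdel_star[OF q_nz] rdel_elems star_linear)
  with C show ?case by simp
qed

text \<open>Deleting the first \<open>X\<close> leaves a difference of two commutators with equal
  values by \<open>comm_H\<close>, since \<open>Yc (l + k + 1)\<close> is symmetric in
  \<open>k\<close> and \<open>l\<close>.\<close>

lemma H_commute: "H k \<star> H l = H l \<star> H k"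
proof -
  have "comm (H k) (H l) = 0"
  proof (rule vec_eqI_left)
    have "ldel X (comm (H k) (H l)) = comm (H k) (Yc l) - comm (H l) (Yc k)"
      by (simp add: comm_def ldel_linear ldel_star ldel_elems wgt_elems)
    then show "ldel X (comm (H k) (H l)) = ldel X 0"
      by (simp add: comm_H ldel_linear add.commute add.left_commute)
  qed (simp_all add: comm_def star_Nil at_Nil pointwise ldel_linear ldel_star ldel_elems star_linear)
  then show ?thesis by (simp add: comm_def)
qed

text \<open>Balances coefficients in \<open>C_recursion\<close>: the first term comes from deleting
  the \<open>X\<close> of \<open>H m\<close>, the sum from moving \<open>H k\<close> past
  \<open>Yc j\<close>.\<close>

lemma qint_sum:
  "qint q (2 * int m + 2) + d * qint q 2 * (\<Sum>k<m. qint q (2 * int k + 2) * q ^ (2 * (m - 1 - k)))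
     = of_nat (m + 1) * qint q 2 * q ^ (2 * m)"
proof (induction m)
  case (Suc m)
  have "(\<Sum>k<m. qint q (2 * int k + 2) * q ^ (2 * (m - k)))
      = q\<^sup>2 * (\<Sum>k<m. qint q (2 * int k + 2) * q ^ (2 * (m - 1 - k)))"
    unfolding sum_distrib_left
  proof (intro sum.cong refl)
    fix k assume "k \<in> {..<m}"
    then have "m - k = Suc (m - 1 - k)" by auto
    then show "qint q (2 * int k + 2) * q ^ (2 * (m - k)) = q\<^sup>2 * (qint q (2 * int k + 2) * q ^ (2 * (m - 1 - k)))"
      by (simp add: power2_eq_square)
  qed
  then have "d * qint q 2 * (\<Sum>k<Suc m. qint q (2 * int k + 2) * q ^ (2 * (Suc m - 1 - k)))
     = q\<^sup>2 * (d * qint q 2 * (\<Sum>k<m. qint q (2 * int k + 2) * q ^ (2 * (m - 1 - k))))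
       + d * qint q 2 * qint q (2 * int m + 2)"
    by (simp add: algebra_simps)
  also have "d * qint q 2 * (\<Sum>k<m. qint q (2 * int k + 2) * q ^ (2 * (m - 1 - k)))
      = of_nat (m + 1) * qint q 2 * q ^ (2 * m) - qint q (2 * int m + 2)"
    using Suc.IH by (simp add: eq_diff_eq add.commute)
  finally have "qint q (2 * int (Suc m) + 2) + d * qint q 2 * (\<Sum>k<Suc m. qint q (2 * int k + 2) * q ^ (2 * (Suc m - 1 - k)))
     = qint q (2 * int m + 4) - q\<^sup>2 * qint q (2 * int m + 2) + d * qint q 2 * qint q (2 * int m + 2)
       + of_nat (m + 1) * qint q 2 * q ^ (2 * Suc m)"
    by (simp add: algebra_simps power2_eq_square)
  \<comment> \<open>Uses that \<open>d * qint q 2\<close> equals q^2 - q^-2.\<close>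
  also have "qint q (2 * int m + 4) - q\<^sup>2 * qint q (2 * int m + 2) + d * qint q 2 * qint q (2 * int m + 2)
      = qint q (2 * int m + 4) - inverse (q\<^sup>2) * qint q (2 * int m + 2)"
    unfolding d_qint by (simp add: power_int_minus algebra_simps)
  also have "\<dots> = qint q 2 * q ^ (2 * Suc m)"
  proof -
    have "d * (qint q (2 * int m + 4) - inverse (q\<^sup>2) * qint q (2 * int m + 2))
        = d * qint q (2 * int m + 4) - inverse (q\<^sup>2) * (d * qint q (2 * int m + 2))"
      by (simp only: right_diff_distrib mult_ac)
    also have "\<dots> = (q\<^sup>2 - inverse (q\<^sup>2)) * q powi (2 * int m + 2)"
      unfolding d_qint using q_nz by (simp add: power_int_add power_int_diff power_int_minus field_simps)
    also have "\<dots> = d * (qint q 2 * q ^ (2 * Suc m))"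
      using d_qint[of 2] power_int_of_nat[of q "2 * Suc m"] by (simp add: power_int_minus ac_simps)
    finally show ?thesis using d_nz by simp
  qed
  finally show ?case by (simp add: algebra_simps)
qed simp

text \<open>Deleting the first \<open>X\<close> yields \<open>Yc k\<close> from \<open>H k\<close>
  and, by \<open>ldel_C_eq_Q\<close>, a multiple of \<open>Q 0\<close> from \<open>C\<close>. Each
  \<open>H k\<close> is moved past \<open>Yc j\<close> by \<open>comm_H\<close>, and the
  coefficients of \<open>Yc m \<star> C (n - 1 - m)\<close> are compared.\<close>

lemma C_recursion: "vscale (of_nat n) (C n) = (\<Sum>k<n. vscale (qint q (2 * int k + 2)) (H k \<star> C (n - 1 - k)))"
proof (induction n rule: less_induct)
  case (less n)
  let ?c = "\<lambda>k. qint q (2 * int k + 2)"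
  show ?case
  proof (rule vec_eqI_left)
    have "(\<Sum>k<n. vscale (?c k) (H k \<star> Q 0 (n - 1 - k)))
        = (\<Sum>k<n. \<Sum>j<n - 1 - k. vscale (?c k * q ^ (2 * j)) (Yc j \<star> (H k \<star> C (n - 1 - k - 1 - j)))
             + vscale (?c k * q ^ (2 * j) * d) (Yc (j + k + 1) \<star> C (n - 1 - k - 1 - j)))"
    proof (intro sum.cong refl)
      fix k
      have "H k \<star> (Yc j \<star> f) = Yc j \<star> (H k \<star> f) + vscale d (Yc (j + k + 1) \<star> f)" for j f
      proof -
        have "H k \<star> Yc j = Yc j \<star> H k + vscale d (Yc (j + k + 1))"
          using comm_H[of k j] by (simp add: comm_def algebra_simps)
        then show ?thesis by (simp add: star_assoc[OF q_nz, symmetric] star_linear)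
      qed
      then show "vscale (?c k) (H k \<star> Q 0 (n - 1 - k))
        = (\<Sum>j<n - 1 - k. vscale (?c k * q ^ (2 * j)) (Yc j \<star> (H k \<star> C (n - 1 - k - 1 - j)))
             + vscale (?c k * q ^ (2 * j) * d) (Yc (j + k + 1) \<star> C (n - 1 - k - 1 - j)))"
        by (simp add: Q_def star_sum star_linear vec.scale_sum_right vec.scale_right_distrib mult.assoc)
    qed
    also have "\<dots> = (\<Sum>k<n. \<Sum>j<n - 1 - k. vscale (?c k * q ^ (2 * j)) (Yc j \<star> (H k \<star> C (n - 1 - k - 1 - j))))
       + (\<Sum>k<n. \<Sum>j<n - 1 - k. vscale (?c k * q ^ (2 * j) * d) (Yc (j + k + 1) \<star> C (n - 1 - k - 1 - j)))"
      by (simp add: sum.distrib)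
    \<comment> \<open>With \<open>H k\<close> next to \<open>C\<close>, the sum over
      \<open>k\<close> is the recursion at the smaller index \<open>n - 1 - j\<close>.\<close>
    also have "(\<Sum>k<n. \<Sum>j<n - 1 - k. vscale (?c k * q ^ (2 * j)) (Yc j \<star> (H k \<star> C (n - 1 - k - 1 - j))))
      = (\<Sum>j<n. vscale (of_nat (n - 1 - j) * q ^ (2 * j)) (Yc j \<star> C (n - 1 - j)))"
    proof (subst sum_triangle_swap, intro sum.cong refl)
      fix j assume "j \<in> {..<n}"
      then have "vscale (of_nat (n - 1 - j)) (C (n - 1 - j)) = (\<Sum>k<n - 1 - j. vscale (?c k) (H k \<star> C (n - 1 - j - 1 - k)))"
        by (intro less) auto
      then have "Yc j \<star> vscale (of_nat (n - 1 - j)) (C (n - 1 - j))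
          = (\<Sum>k<n - 1 - j. vscale (?c k) (Yc j \<star> (H k \<star> C (n - 1 - j - 1 - k))))"
        by (simp add: star_sum star_linear)
      then have "vscale (q ^ (2 * j)) (vscale (of_nat (n - 1 - j)) (Yc j \<star> C (n - 1 - j)))
          = (\<Sum>k<n - 1 - j. vscale (?c k * q ^ (2 * j)) (Yc j \<star> (H k \<star> C (n - 1 - j - 1 - k))))"
        by (simp add: star_linear vec.scale_sum_right mult.commute)
      moreover have "n - 1 - j - 1 - k = n - 1 - k - 1 - j" for k by simp
      ultimately show "(\<Sum>k<n - 1 - j. vscale (?c k * q ^ (2 * j)) (Yc j \<star> (H k \<star> C (n - 1 - k - 1 - j))))
          = vscale (of_nat (n - 1 - j) * q ^ (2 * j)) (Yc j \<star> C (n - 1 - j))"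
        by (simp add: mult.commute)
    qed
    \<comment> \<open>Apart from scalars, the commutator terms depend only on
      \<open>m = j + k + 1\<close>.\<close>
    also have "(\<Sum>k<n. \<Sum>j<n - 1 - k. vscale (?c k * q ^ (2 * j) * d) (Yc (j + k + 1) \<star> C (n - 1 - k - 1 - j)))
       = (\<Sum>m<n. vscale (d * (\<Sum>k<m. ?c k * q ^ (2 * (m - 1 - k)))) (Yc m \<star> C (n - 1 - m)))"
      unfolding sum_triangle_diagonal
    proof (intro sum.cong refl)
      fix m
      have "(\<Sum>k<m. vscale (?c k * q ^ (2 * (m - 1 - k)) * d) (Yc (m - 1 - k + k + 1) \<star> C (n - 1 - k - 1 - (m - 1 - k))))
         = (\<Sum>k<m. vscale (?c k * q ^ (2 * (m - 1 - k)) * d) (Yc m \<star> C (n - 1 - m)))"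
        by (intro sum.cong refl) auto
      then show "(\<Sum>k<m. vscale (?c k * q ^ (2 * (m - 1 - k)) * d) (Yc (m - 1 - k + k + 1) \<star> C (n - 1 - k - 1 - (m - 1 - k))))
         = vscale (d * (\<Sum>k<m. ?c k * q ^ (2 * (m - 1 - k)))) (Yc m \<star> C (n - 1 - m))"
        by (simp only: vec.scale_sum_left sum_distrib_left mult_ac)
    qed
    finally have T: "(\<Sum>k<n. vscale (?c k) (H k \<star> Q 0 (n - 1 - k)))
        = (\<Sum>j<n. vscale (of_nat (n - 1 - j) * q ^ (2 * j)) (Yc j \<star> C (n - 1 - j)))
        + (\<Sum>m<n. vscale (d * (\<Sum>k<m. ?c k * q ^ (2 * (m - 1 - k)))) (Yc m \<star> C (n - 1 - m)))" .
    have "ldel X (\<Sum>k<n. vscale (?c k) (H k \<star> C (n - 1 - k)))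
        = (\<Sum>k<n. vscale (?c k) (Yc k \<star> C (n - 1 - k))) + vscale (qint q 2) (\<Sum>k<n. vscale (?c k) (H k \<star> Q 0 (n - 1 - k)))"
      by (simp add: ldel_linear ldel_star ldel_elems wgt_elems ldel_C_eq_Q star_linear vec.scale_right_distrib
          sum.distrib vec.scale_sum_right mult.commute)
    also have "\<dots> = (\<Sum>m<n. vscale (?c m + qint q 2 * (of_nat (n - 1 - m) * q ^ (2 * m))
         + qint q 2 * (d * (\<Sum>k<m. ?c k * q ^ (2 * (m - 1 - k))))) (Yc m \<star> C (n - 1 - m)))"
      unfolding T by (simp add: vec.scale_right_distrib vec.scale_sum_right vec.scale_left_distrib sum.distrib)
    also have "\<dots> = (\<Sum>m<n. vscale (of_nat n * qint q 2 * q ^ (2 * m)) (Yc m \<star> C (n - 1 - m)))"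
    proof (intro sum.cong refl)
      fix m assume "m \<in> {..<n}"
      then have "n = (m + 1) + (n - 1 - m)" by auto
      then have "(of_nat n :: 'a) = of_nat (m + 1) + of_nat (n - 1 - m)" by (metis of_nat_add)
      moreover have "?c m + qint q 2 * (of_nat (n - 1 - m) * q ^ (2 * m)) + qint q 2 * (d * (\<Sum>k<m. ?c k * q ^ (2 * (m - 1 - k))))
         = (?c m + d * qint q 2 * (\<Sum>k<m. ?c k * q ^ (2 * (m - 1 - k)))) + of_nat (n - 1 - m) * (qint q 2 * q ^ (2 * m))"
        by (simp only: ac_simps)
      ultimately have "?c m + qint q 2 * (of_nat (n - 1 - m) * q ^ (2 * m)) + qint q 2 * (d * (\<Sum>k<m. ?c k * q ^ (2 * (m - 1 - k))))
         = of_nat n * qint q 2 * q ^ (2 * m)"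
        unfolding qint_sum by (simp only: distrib_right mult.assoc)
      then show "vscale (?c m + qint q 2 * (of_nat (n - 1 - m) * q ^ (2 * m))
         + qint q 2 * (d * (\<Sum>k<m. ?c k * q ^ (2 * (m - 1 - k))))) (Yc m \<star> C (n - 1 - m))
         = vscale (of_nat n * qint q 2 * q ^ (2 * m)) (Yc m \<star> C (n - 1 - m))" by simp
    qed
    also have "\<dots> = ldel X (vscale (of_nat n) (C n))"
      by (simp add: ldel_linear ldel_C_eq_Q Q_def vec.scale_sum_right mult.assoc)
    finally show "ldel X (vscale (of_nat n) (C n)) = ldel X (\<Sum>k<n. vscale (?c k) (H k \<star> C (n - 1 - k)))" by simp
    show "vscale (of_nat n) (C n) [] = (\<Sum>k<n. vscale (?c k) (H k \<star> C (n - 1 - k))) []"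
      by (simp add: at_Nil star_Nil sum_fun_at pointwise)
  qed (simp add: ldel_linear ldel_star ldel_elems ldel_C star_linear)
qed

end

section \<open>The exponential and the homomorphism\<close>

lemma finite_comps: "finite (comps n m)"
proof (rule finite_subset)
  show "comps n m \<subseteq> {ks. set ks \<subseteq> {..n} \<and> length ks = m}"
    by (auto simp: comps_def dest: member_le_sum_list)
qed (simp add: finite_lists_length_eq)

lemma comps_0: "comps n 0 = (if n = 0 then {[]} else {})"
  by (auto simp: comps_def)

text \<open>The first part is written \<open>Suc k\<close> with \<open>k < n\<close>, which keeps
  the subtraction \<open>n - 1 - k\<close> exact.\<close>

lemma comps_Suc: "comps n (Suc m) = (\<Union>k<n. (#) (Suc k) ` comps (n - 1 - k) m)"
proof (rule set_eqI)
  fix ks show "ks \<in> comps n (Suc m) \<longleftrightarrow> ks \<in> (\<Union>k<n. (#) (Suc k) ` comps (n - 1 - k) m)"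
  proof (cases ks)
    case (Cons j js)
    show ?thesis
    proof
      assume "ks \<in> comps n (Suc m)"
      with Cons have "j = Suc (j - 1)" "js \<in> comps (n - 1 - (j - 1)) m" "j - 1 < n"
        by (auto simp: comps_def)
      with Cons show "ks \<in> (\<Union>k<n. (#) (Suc k) ` comps (n - 1 - k) m)" by blast
    qed (auto simp: comps_def)
  qed (auto simp: comps_def)
qed

lemma sum_comps_Suc:
  "(\<Sum>ks\<in>comps n (Suc m). G ks) = (\<Sum>k<n. \<Sum>ks\<in>comps (n - 1 - k) m. (G (Suc k # ks) :: 'b::comm_monoid_add))"
  unfolding comps_Suc
  by (subst sum.UNION_disjoint) (auto simp: finite_comps sum.reindex)

lemma comps_empty: "n < m \<Longrightarrow> comps n m = {}"
proof (induction m arbitrary: n)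
  case (Suc m)
  then show ?case unfolding comps_Suc by auto
qed simp

text \<open>The remaining parts have a positive sum. Solving the exponential identity degree by
  degree rests on this bound.\<close>

lemma comps_less:
  assumes "ks \<in> comps n m" "2 \<le> m" "k \<in> set ks"
  shows "0 < k" "k < n"
proof -
  from assms(3) obtain us vs where ks: "ks = us @ k # vs" by (meson split_list)
  with assms(1,2) have "us @ vs \<noteq> []" by (auto simp: comps_def)
  then obtain j where "j \<in> set (us @ vs)" using last_in_set by blast
  moreover from this have "j \<le> sum_list (us @ vs)" by (rule member_le_sum_list) simp
  moreover have "0 < j" "0 < k" using assms(1) ks \<open>j \<in> set (us @ vs)\<close> by (auto simp: comps_def)
  moreover have "n = sum_list (us @ vs) + k" using assms(1) ks by (simp add: comps_def)
  ultimately show "0 < k" "k < n" by linarith+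
qed

lemma sum_comps_split:
  fixes G :: "nat list \<Rightarrow> 'a::field_char_0 vec"
  assumes "1 \<le> n"
  shows "(\<Sum>m\<le>n. vscale (1 / fact m) (\<Sum>ks\<in>comps n m. G ks))
    = G [n] + (\<Sum>m\<in>{2..n}. vscale (1 / fact m) (\<Sum>ks\<in>comps n m. G ks))"
proof -
  have "{..n} = insert 0 (insert 1 {2..n})" using assms by auto
  moreover have "comps n 1 = {[n]}"
  proof (rule set_eqI)
    fix ks show "ks \<in> comps n 1 \<longleftrightarrow> ks \<in> {[n]}"
      using assms by (cases ks) (auto simp: comps_def)
  qed
  ultimately show ?thesis using assms by (simp add: comps_0)
qed

text \<open>\<open>natural\<close> sums over the support of its argument, and a sum over an infinite
  set defaults to 0; finite support therefore has to be established.\<close>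

definition finsupp :: "'a::zero vec \<Rightarrow> bool" where
  "finsupp f \<longleftrightarrow> finite {w. f w \<noteq> 0}"

lemma finsupp_subset: "finsupp f \<Longrightarrow> (\<And>w. f w = 0 \<Longrightarrow> g w = 0) \<Longrightarrow> finsupp g"
  unfolding finsupp_def by (rule finite_subset[of _ "{w. f w \<noteq> 0}"]) auto

lemma finsupp_single: "finsupp (single u)"
  unfolding finsupp_def by (rule finite_subset[of _ "{u}"]) (auto simp: single_def)

lemma finsupp_add: "finsupp f \<Longrightarrow> finsupp g \<Longrightarrow> finsupp (f + g :: 'a::ab_group_add vec)"
  unfolding finsupp_def by (rule finite_subset[of _ "{w. f w \<noteq> 0} \<union> {w. g w \<noteq> 0}"]) (auto simp: pointwise)

lemma finsupp_diff: "finsupp f \<Longrightarrow> finsupp g \<Longrightarrow> finsupp (f - g :: 'a::ab_group_add vec)"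
  unfolding finsupp_def by (rule finite_subset[of _ "{w. f w \<noteq> 0} \<union> {w. g w \<noteq> 0}"]) (auto simp: pointwise)

lemma finsupp_vscale: "finsupp f \<Longrightarrow> finsupp (vscale s f :: 'a::field vec)"
  by (erule finsupp_subset) (simp add: pointwise)

lemma finsupp_zero: "finsupp 0"
  by (simp add: finsupp_def pointwise)

lemma finsupp_sum: "(\<And>i. i \<in> I \<Longrightarrow> finsupp (h i)) \<Longrightarrow> finsupp (\<Sum>i\<in>I. h i :: 'a::ab_group_add vec)"
  by (induction I rule: infinite_finite_induct) (auto intro: finsupp_add finsupp_zero)

lemma finsupp_conc:
  assumes "finsupp f" "finsupp g" shows "finsupp (conc f g)"
proof -
  have "{w. conc f g w \<noteq> 0} \<subseteq> (\<lambda>(u, v). u @ v) ` ({w. f w \<noteq> 0} \<times> {w. g w \<noteq> 0})"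
    by (auto elim!: conc_nonzeroE)
  then show ?thesis using assms unfolding finsupp_def by (meson finite_SigmaI finite_imageI finite_subset)
qed

lemma finsupp_cprod: "(\<And>f. f \<in> set fs \<Longrightarrow> finsupp f) \<Longrightarrow> finsupp (cprod fs)"
  by (induction fs) (auto intro: finsupp_conc finsupp_single)

lemma expco_eq: "expco a n = (\<Sum>m\<le>n. vscale (1 / fact m) (\<Sum>ks\<in>comps n m. cprod (map a ks)))"
  by (simp add: expco_def fun_eq_iff sum_fun_at pointwise)

section \<open>Multiplicativity of the homomorphism\<close>

context generic_q begin

lemma finsupp_Ea1: "finsupp (Ea1 q n)"
  by (induction n) (auto simp: fA_def fB_def Edelta1_def vsub_eq
    intro!: finsupp_vscale finsupp_diff finsupp_conc finsupp_single)

lemma finsupp_Edel: "finsupp (Edel q n)"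
  by (auto simp: Edel_def fA_def vsub_eq intro!: finsupp_vscale finsupp_diff finsupp_conc finsupp_single finsupp_Ea1)

lemma wimg_length: "wimg q u v \<noteq> 0 \<Longrightarrow> length u = length v"
proof (induction u arbitrary: v)
  case Nil
  then show ?case by (auto simp: single_def split: if_splits)
next
  case (Cons a u)
  show ?case
  proof (rule ccontr)
    assume *: "length (a # u) \<noteq> length v"
    \<comment> \<open>For different lengths no pair of words contributes, as in the product
      \<open>0 \<star> 0\<close>.\<close>
    have "wimg q (a # u) v = (0 \<star> 0) v"
      unfolding wimg.simps by (rule star_cong) (use * Cons.IH in \<open>force simp: single_def pointwise\<close>)
    with Cons.prems show False by (simp add: star_linear pointwise)
  qed
qed

lemma wimg_eq_0: "length u \<noteq> length v \<Longrightarrow> wimg q u v = 0"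
  using wimg_length by blast

text \<open>Since \<open>wimg\<close> preserves lengths, \<open>natural\<close> can be written as a sum over words of bounded length; in contrast to the
  original it is then multiplicative without any hypothesis of finite support.\<close>
definition img :: "'a vec \<Rightarrow> 'a vec" where
  "img f v = (\<Sum>u\<in>words (length v). f u * wimg q u v)"

lemma img_bound: "length v \<le> n \<Longrightarrow> img f v = (\<Sum>u\<in>words n. f u * wimg q u v)"
  unfolding img_def
  by (rule sum.mono_neutral_left) (auto simp: finite_words wimg_eq_0)

lemma img_linear: "img (f + g) = img f + img g" "img (f - g) = img f - img g" "img (vscale s f) = vscale s (img f)"
  "img 0 = 0"
  by (auto simp: img_def fun_eq_iff pointwise algebra_simps sum.distrib sum_subtractf sum_distrib_left)

lemma img_sum: "img (\<Sum>i\<in>I. h i) = (\<Sum>i\<in>I. img (h i))"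
  by (induction I rule: infinite_finite_induct) (auto simp: img_linear)

lemma natural_eq_img:
  assumes "finsupp f" shows "natural q f = img f"
proof (rule ext)
  fix v :: "letter list"
  let ?U = "{w. f w \<noteq> 0} \<union> words (length v)"
  have "natural q f v = (\<Sum>w\<in>?U. f w * wimg q w v)"
    unfolding natural_def
    by (rule sum.mono_neutral_left) (use assms finite_words in \<open>auto simp: finsupp_def\<close>)
  also have "\<dots> = img f v"
    unfolding img_def
    by (rule sum.mono_neutral_right) (use assms finite_words in \<open>auto simp: finsupp_def wimg_eq_0\<close>)
  finally show "natural q f v = img f v" .
qed

text \<open>The letter uses up one unit of length, which allows \<open>img_conc\<close> to go by
  induction on length.\<close>

lemma star_letter_cong:
  assumes "\<And>u. length u < length v \<Longrightarrow> f u = g u"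
  shows "(single [a] \<star> f) v = (single [a] \<star> g) v"
  by (rule star_cong) (use assms in \<open>auto simp: single_def\<close>)

lemma star_letter_img: "(single [a] \<star> img f) v = (\<Sum>u\<in>words (length v). f u * wimg q (a # u) v)"
proof -
  have "(single [a] \<star> img f) v = (single [a] \<star> (\<Sum>u\<in>words (length v). vscale (f u) (wimg q u))) v"
    by (rule star_letter_cong) (simp add: img_bound[of _ "length v"] sum_fun_at pointwise)
  then show ?thesis by (simp add: star_sum star_linear sum_fun_at pointwise)
qed

text \<open>Splitting words by their first letter mirrors the recursion of
  \<open>wimg\<close>.\<close>

lemma img_rec: "img f = vscale (f []) (single []) + x \<star> img (ldel X f) + y \<star> img (ldel Y f)"
proof (rule ext)
  fix v
  have "img f v = (\<Sum>u\<in>words (Suc (length v)). f u * wimg q u v)"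
    by (rule img_bound) simp
  then show "img f v = (vscale (f []) (single []) + x \<star> img (ldel X f) + y \<star> img (ldel Y f)) v"
    by (simp add: sum_words_Suc x_def y_def star_letter_img ldel_def pointwise)
qed

lemma img_one: "img (single []) = single []"
proof -
  have "ldel a (single [] :: 'a vec) = 0" for a by (simp add: ldel_def single_def fun_eq_iff pointwise)
  moreover have "single [] [] = (1 :: 'a)" by (simp add: single_def)
  ultimately show ?thesis by (subst img_rec) (simp add: img_linear star_linear)
qed

lemma img_letters: "img fA = x" "img fB = y"
proof -
  have "img x = x" unfolding img_rec[of x] by (simp add: del_letters letters_Nil img_linear img_one star_linear)
  then show "img fA = x" by (simp add: fA_def x_def)
  have "img y = y" unfolding img_rec[of y] by (simp add: del_letters letters_Nil img_linear img_one star_linear)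
  then show "img fB = y" by (simp add: fB_def y_def)
qed

text \<open>Both sides are expanded by \<open>img_rec\<close>. The induction hypothesis holds only
  on shorter words and is applied behind a letter through \<open>star_letter_cong\<close>;
  associativity regroups the factors.\<close>

lemma img_conc: "img (conc f g) = img f \<star> img g"
proof (rule ext)
  fix v show "img (conc f g) v = (img f \<star> img g) v"
  proof (induction v arbitrary: f g rule: measure_induct_rule[of length])
    case (less v)
    have "img (conc f g) = vscale (f []) (vscale (g []) (single []) + x \<star> img (ldel X g) + y \<star> img (ldel Y g))
        + x \<star> img (conc (ldel X f) g) + y \<star> img (conc (ldel Y f) g)"
    proof -
      have "img (ldel a (conc f g)) = vscale (f []) (img (ldel a g)) + img (conc (ldel a f) g)" for a
        by (simp add: ldel_conc img_linear)
      then have "img (conc f g) = vscale (f [] * g []) (single [])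
          + x \<star> (vscale (f []) (img (ldel X g)) + img (conc (ldel X f) g))
          + y \<star> (vscale (f []) (img (ldel Y g)) + img (conc (ldel Y f) g))"
        by (simp only: img_rec[of "conc f g"] conc_Nil)
      then show ?thesis by (simp add: star_linear vec.scale_right_distrib add_ac)
    qed
    also have "vscale (g []) (single []) + x \<star> img (ldel X g) + y \<star> img (ldel Y g) = img g"
      by (rule img_rec[symmetric])
    finally have "img (conc f g) v = (vscale (f []) (img g) + x \<star> img (conc (ldel X f) g) + y \<star> img (conc (ldel Y f) g)) v"
      by simp
    also have "\<dots> = (vscale (f []) (img g) + x \<star> (img (ldel X f) \<star> img g) + y \<star> (img (ldel Y f) \<star> img g)) v"
    proof -
      have "(single [a] \<star> img (conc h g)) v = (single [a] \<star> (img h \<star> img g)) v" for a h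
        by (rule star_letter_cong) (rule less)
      then show ?thesis by (simp only: pointwise x_def y_def)
    qed
    also have "vscale (f []) (img g) + x \<star> (img (ldel X f) \<star> img g) + y \<star> (img (ldel Y f) \<star> img g)
        = (vscale (f []) (single []) + x \<star> img (ldel X f) + y \<star> img (ldel Y f)) \<star> img g"
      by (simp add: star_linear star_assoc[OF q_nz])
    also have "vscale (f []) (single []) + x \<star> img (ldel X f) + y \<star> img (ldel Y f) = img f"
      by (rule img_rec[symmetric])
    finally show ?case .
  qed
qed

section \<open>Images of the elements E\<close>

lemma C_1: "C 1 = vscale (qint q 2) xy"
proof (rule vec_eqI_left)
  show "C 1 [] = vscale (qint q 2) xy []" by (simp add: at_Nil letters_Nil pointwise)
  show "ldel X (C 1) = ldel X (vscale (qint q 2) xy)"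
    by (simp add: ldel_C_eq_Q Q_def Yc_0 C_0 ldel_linear del_letters)
qed (simp add: ldel_C ldel_linear del_letters)

text \<open>Up to the factor -q^-2 this is the left side of \<open>x_Yc\<close> at
  \<open>n = 0\<close>.\<close>

lemma img_Edelta1: "img (Edelta1 q) = vscale (- inverse (q\<^sup>2) * d * qint q 2) xy"
proof -
  have "img (Edelta1 q) = vscale (inverse (q\<^sup>2)) (y \<star> x) - x \<star> y"
    by (simp add: Edelta1_def vsub_eq img_linear img_conc img_letters power_int_minus)
  also have "\<dots> = vscale (- inverse (q\<^sup>2)) (vscale (q\<^sup>2) (x \<star> Yc 0) - Yc 0 \<star> x)"
    using q_nz by (simp add: Yc_0 fun_eq_iff pointwise algebra_simps)
  also have "\<dots> = vscale (- inverse (q\<^sup>2) * d * qint q 2) xy"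
    unfolding x_Yc using C_1 by (simp add: mult.assoc)
  finally show ?thesis .
qed

text \<open>The scalar gained per step of the recursion for \<open>Ea1\<close>, and thus per power
  of t.\<close>

abbreviation "r \<equiv> inverse (q\<^sup>2) * d\<^sup>2"

lemma qint_2_nz: "q + inverse q \<noteq> 0"
proof
  assume "q + inverse q = 0"
  then have "q * (q + inverse q) = 0" by simp
  then have "q ^ 2 = - 1" using q_nz by (simp add: distrib_left power2_eq_square eq_neg_iff_add_eq_0)
  then have "q ^ 4 = 1" using power_mult[of q 2 2] by simp
  then show False using q_not_root[of 4] by simp
qed

lemma img_Ea1: "img (Ea1 q n) = vscale (r ^ n) (Yc n)"
proof (induction n)
  case 0
  show ?case by (simp add: img_letters Yc_0)
next
  case (Suc n)
  define s t where "s = r ^ n" and "t = inverse (q\<^sup>2) * d * qint q 2"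
  have "img (Ea1 q n) = vscale s (Yc n)" "img (Edelta1 q) = vscale (- t) xy"
    by (simp_all add: Suc img_Edelta1 s_def t_def)
  then have "img (Ea1 q (Suc n)) = vscale (1 / (q + inverse q)) (vscale (s * t) (comm xy (Yc n)))"
    by (simp add: vsub_eq img_linear img_conc star_linear comm_def vec.scale_right_diff_distrib mult_ac)
  also have "\<dots> = vscale (r ^ Suc n) (Yc (Suc n))"
    unfolding comm_xy_Yc using qint_2_nz by (simp add: s_def t_def qint_2 power2_eq_square mult_ac)
  finally show ?case .
qed

text \<open>The definition of \<open>Edel\<close> is again a multiple of the left side of
  \<open>x_Yc\<close>. With \<open>C 0 = single []\<close>, the right side of the exponential
  identity maps to the series of \<open>r ^ n\<close> times \<open>C n\<close>.\<close>

lemma img_Edel: "1 \<le> n \<Longrightarrow> img (vscale (- d) (Edel q n)) = vscale (r ^ n) (C n)"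
proof -
  assume "1 \<le> n"
  then obtain m where n: "n = Suc m" by (cases n) auto
  define s where "s = r ^ m"
  have "img (vscale (- d) (Edel q n)) = vscale (- d) (vscale (inverse (q\<^sup>2) * s) (Yc m \<star> x) - vscale s (x \<star> Yc m))"
    by (simp add: n Edel_def vsub_eq img_linear img_conc img_letters img_Ea1 s_def star_linear power_int_minus)
  also have "\<dots> = vscale (s * d * inverse (q\<^sup>2)) (vscale (q\<^sup>2) (x \<star> Yc m) - Yc m \<star> x)"
  proof -
    have "vscale (- e) (vscale (inverse (q\<^sup>2) * s) f - vscale s g) = vscale (s * e * inverse (q\<^sup>2)) (vscale (q\<^sup>2) g - f)" for e f g
      using q_nz by (simp add: vec.scale_right_diff_distrib mult_ac)
    then show ?thesis .
  qed
  finally show ?thesis unfolding x_Yc by (simp add: n s_def power2_eq_square mult_ac)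
qed

section \<open>Exponentials in the q-shuffle algebra\<close>

fun sprod :: "'a vec list \<Rightarrow> 'a vec" where
  "sprod [] = single []"
| "sprod (f # fs) = f \<star> sprod fs"

lemma img_cprod: "img (cprod fs) = sprod (map img fs)"
  by (induction fs) (simp_all add: img_one img_conc)

text \<open>The coefficient of t^n in the m-th power of the series of the a_k t^k, before division
  by m!.\<close>

definition sexp_part :: "(nat \<Rightarrow> 'a vec) \<Rightarrow> nat \<Rightarrow> nat \<Rightarrow> 'a vec" where
  "sexp_part a m n = (\<Sum>ks\<in>comps n m. sprod (map a ks))"

definition sexp :: "(nat \<Rightarrow> 'a vec) \<Rightarrow> nat \<Rightarrow> 'a vec" where
  "sexp a n = (\<Sum>m\<le>n. vscale (1 / fact m) (sexp_part a m n))"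

lemma img_expco: "img (expco a n) = sexp (\<lambda>k. img (a k)) n"
  by (simp add: expco_eq sexp_def sexp_part_def img_sum img_linear img_cprod comp_def)

text \<open>The system is triangular: degree \<open>n\<close> contains \<open>a n\<close> linearly,
  and the products of two or more factors involve only smaller indices.\<close>

lemma sexp_inj:
  assumes "\<And>k. 1 \<le> k \<Longrightarrow> sexp a k = sexp b k" and "1 \<le> n"
  shows "a n = b n"
  using \<open>1 \<le> n\<close>
proof (induction n rule: less_induct)
  case (less n)
  have "sprod (map a ks) = sprod (map b ks)" if "ks \<in> comps n m" "2 \<le> m" for ks m
  proof -
    have "map a ks = map b ks" using less.IH comps_less[OF that] by (simp add: Suc_le_eq)
    then show ?thesis by (simp only:)
  qed
  then have "(\<Sum>m\<in>{2..n}. vscale (1 / fact m) (\<Sum>ks\<in>comps n m. sprod (map a ks)))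
      = (\<Sum>m\<in>{2..n}. vscale (1 / fact m) (\<Sum>ks\<in>comps n m. sprod (map b ks)))" by simp
  then show ?case
    using assms(1)[OF less.prems] sum_comps_split[OF less.prems, of "\<lambda>ks. sprod (map a ks)"]
      sum_comps_split[OF less.prems, of "\<lambda>ks. sprod (map b ks)"]
    by (simp add: sexp_def sexp_part_def)
qed

lemma sexp_part_Suc: "sexp_part a (Suc m) n = (\<Sum>k<n. a (Suc k) \<star> sexp_part a m (n - 1 - k))"
  by (simp add: sexp_part_def sum_comps_Suc star_sum)

text \<open>The coefficient of t^n in t (A^m)' = m (t A') A^(m-1), valid because the coefficients of
  A commute.\<close>

lemma sexp_part_deriv:
  assumes comm: "\<And>j k. a (Suc j) \<star> a (Suc k) = a (Suc k) \<star> a (Suc j)"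
  shows "vscale (of_nat n) (sexp_part a m n)
    = vscale (of_nat m) (\<Sum>k<n. vscale (of_nat (Suc k)) (a (Suc k) \<star> sexp_part a (m - 1) (n - 1 - k)))"
proof (induction m arbitrary: n)
  case 0
  show ?case by (simp add: sexp_part_def comps_0)
next
  case (Suc m)
  let ?T = "\<Sum>k<n. vscale (of_nat (Suc k)) (a (Suc k) \<star> sexp_part a m (n - 1 - k))"
  have "vscale (of_nat n) (sexp_part a (Suc m) n)
      = (\<Sum>k<n. vscale (of_nat (Suc k)) (a (Suc k) \<star> sexp_part a m (n - 1 - k))
          + a (Suc k) \<star> vscale (of_nat (n - 1 - k)) (sexp_part a m (n - 1 - k)))"
    unfolding sexp_part_Suc vec.scale_sum_right
  proof (intro sum.cong refl)
    fix k assume "k \<in> {..<n}"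
    then have "n = Suc k + (n - 1 - k)" by auto
    then have "(of_nat n :: 'a) = of_nat (Suc k) + of_nat (n - 1 - k)" by (metis of_nat_add)
    then show "vscale (of_nat n) (a (Suc k) \<star> sexp_part a m (n - 1 - k))
       = vscale (of_nat (Suc k)) (a (Suc k) \<star> sexp_part a m (n - 1 - k))
          + a (Suc k) \<star> vscale (of_nat (n - 1 - k)) (sexp_part a m (n - 1 - k))"
      by (simp only: star_linear vec.scale_left_distrib)
  qed
  also have "\<dots> = ?T + (\<Sum>k<n. a (Suc k) \<star> vscale (of_nat (n - 1 - k)) (sexp_part a m (n - 1 - k)))"
    by (rule sum.distrib)
  also have "(\<Sum>k<n. a (Suc k) \<star> vscale (of_nat (n - 1 - k)) (sexp_part a m (n - 1 - k))) = vscale (of_nat m) ?T"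
  proof (cases m)
    case 0
    have "vscale (of_nat j) (sexp_part a m j) = 0" for j using Suc.IH[of j] by (simp add: 0)
    then show ?thesis by (simp only: 0 star_linear(10) sum.neutral_const of_nat_0 vec.scale_zero_left)
  next
    case (Suc l)
    let ?F = "\<lambda>k j. a (Suc k) \<star> (a (Suc j) \<star> sexp_part a l (n - 1 - k - 1 - j))"
    have "(\<Sum>k<n. a (Suc k) \<star> vscale (of_nat (n - 1 - k)) (sexp_part a m (n - 1 - k)))
       = vscale (of_nat m) (\<Sum>k<n. \<Sum>j<n - 1 - k. vscale (of_nat (Suc j)) (?F k j))"
      unfolding Suc.IH by (simp add: Suc star_sum star_linear vec.scale_sum_right)
    also have "(\<Sum>k<n. \<Sum>j<n - 1 - k. vscale (of_nat (Suc j)) (?F k j))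
       = (\<Sum>j<n. \<Sum>k<n - 1 - j. vscale (of_nat (Suc j)) (?F k j))"
      by (rule sum_triangle_swap)
    \<comment> \<open>Exchanging the two commuting factors turns the inner sum over \<open>k\<close>
      back into \<open>sexp_part a m\<close>.\<close>
    also have "\<dots> = ?T"
    proof (intro sum.cong refl)
      fix j
      have "?F k j = a (Suc j) \<star> (a (Suc k) \<star> sexp_part a l (n - 1 - j - 1 - k))" for k
      proof -
        have "n - 1 - k - 1 - j = n - 1 - j - 1 - k" by simp
        then show ?thesis using comm[of k j] by (metis star_assoc[OF q_nz])
      qed
      then show "(\<Sum>k<n - 1 - j. vscale (of_nat (Suc j)) (?F k j))
          = vscale (of_nat (Suc j)) (a (Suc j) \<star> sexp_part a m (n - 1 - j))"
        by (simp only: Suc sexp_part_Suc star_sum vec.scale_sum_right)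
    qed
    finally show ?thesis .
  qed
  also have "?T + vscale (of_nat m) ?T = vscale (of_nat (Suc m)) ?T"
    by (simp add: vec.scale_left_distrib)
  finally show ?case by simp
qed

lemma sexp_bound: "n \<le> N \<Longrightarrow> sexp a n = (\<Sum>m\<le>N. vscale (1 / fact m) (sexp_part a m n))"
  unfolding sexp_def by (rule sum.mono_neutral_left) (auto simp: sexp_part_def comps_empty)

text \<open>The coefficient of t^n in t (exp A)' = (t A') exp A.\<close>

lemma sexp_deriv:
  assumes "\<And>j k. a (Suc j) \<star> a (Suc k) = a (Suc k) \<star> a (Suc j)"
  shows "vscale (of_nat n) (sexp a n) = (\<Sum>k<n. vscale (of_nat (Suc k)) (a (Suc k) \<star> sexp a (n - 1 - k)))"
proof (cases n)
  case (Suc l)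
  let ?T = "\<lambda>m. \<Sum>k<n. vscale (of_nat (Suc k)) (a (Suc k) \<star> sexp_part a m (n - 1 - k))"
  have "vscale (of_nat n) (sexp a n) = (\<Sum>m\<le>Suc l. vscale (1 / fact m) (vscale (of_nat n) (sexp_part a m n)))"
    unfolding sexp_def Suc vec.scale_sum_right by (simp only: vec.scale_scale mult.commute)
  also have "\<dots> = (\<Sum>m\<le>Suc l. vscale (of_nat m / fact m) (?T (m - 1)))"
    unfolding sexp_part_deriv[of a, OF assms] by simp
  \<comment> \<open>The term \<open>m = 0\<close> has coefficient 0; after the shift the factor m+1
    cancels against (m+1)!.\<close>
  also have "\<dots> = (\<Sum>m\<le>l. vscale (of_nat (Suc m) / fact (Suc m)) (?T m))"
    by (subst sum.atMost_Suc_shift) simp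
  also have "\<dots> = (\<Sum>m\<le>l. vscale (1 / fact m) (?T m))"
    by (simp only: fact_Suc of_nat_mult) (simp del: of_nat_Suc)
  also have "\<dots> = (\<Sum>k<n. vscale (of_nat (Suc k)) (a (Suc k) \<star> (\<Sum>m\<le>l. vscale (1 / fact m) (sexp_part a m (n - 1 - k)))))"
    unfolding vec.scale_sum_right star_sum star_linear
    by (subst sum.swap) (simp only: vec.scale_scale mult.commute)
  also have "\<dots> = (\<Sum>k<n. vscale (of_nat (Suc k)) (a (Suc k) \<star> sexp a (n - 1 - k)))"
    by (intro sum.cong refl) (subst sexp_bound[where N = l], auto simp: Suc)
  finally show ?thesis .
qed simp

text \<open>The expected image of \<open>Beck n\<close> times q - q^-1, that is, of the whole
  exponent.\<close>

definition "beck n = vscale (qint q (int (2 * n)) / of_nat n * r ^ n) (H (n - 1))"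

text \<open>By \<open>sexp_deriv\<close> and \<open>C_recursion\<close> both sides satisfy the same
  recursion with the same start; characteristic 0 permits division by \<open>n\<close>.\<close>

lemma sexp_beck: "sexp beck n = vscale (r ^ n) (C n)"
proof (induction n rule: less_induct)
  case (less n)
  show ?case
  proof (cases "n = 0")
    case True
    then show ?thesis by (simp add: sexp_def sexp_part_def comps_0 C_0)
  next
    case False
    have "vscale (of_nat n) (sexp beck n) = (\<Sum>k<n. vscale (of_nat (Suc k)) (beck (Suc k) \<star> sexp beck (n - 1 - k)))"
      by (rule sexp_deriv) (simp add: beck_def star_linear H_commute mult.commute)
    also have "\<dots> = (\<Sum>k<n. vscale (r ^ n) (vscale (qint q (2 * int k + 2)) (H k \<star> C (n - 1 - k))))"
    proof (intro sum.cong refl)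
      fix k assume "k \<in> {..<n}"
      then have "r ^ n = r ^ Suc k * r ^ (n - 1 - k)" by (simp flip: power_add power_Suc)
      moreover have "sexp beck (n - 1 - k) = vscale (r ^ (n - 1 - k)) (C (n - 1 - k))"
        using \<open>k \<in> {..<n}\<close> by (intro less) auto
      moreover have "int (2 * Suc k) = 2 * int k + 2" by simp
      moreover have "of_nat (Suc k) * (w * (z / of_nat (Suc k) * u)) = u * w * z" for z u w :: 'a
        by (simp del: of_nat_Suc)
      ultimately show "vscale (of_nat (Suc k)) (beck (Suc k) \<star> sexp beck (n - 1 - k))
         = vscale (r ^ n) (vscale (qint q (2 * int k + 2)) (H k \<star> C (n - 1 - k)))"
        by (simp only: beck_def star_linear vec.scale_scale diff_Suc_1)
    qed
    also have "\<dots> = vscale (of_nat n) (vscale (r ^ n) (C n))"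
      unfolding vec.scale_sum_right[symmetric] C_recursion[symmetric] by (simp only: vec.scale_scale mult.commute)
    finally have *: "vscale (of_nat n) (sexp beck n) = vscale (of_nat n) (vscale (r ^ n) (C n))" .
    have "of_nat n \<noteq> (0 :: 'a)" using False by simp
    from vec.scale_left_imp_eq[OF this *] show ?thesis .
  qed
qed

end

theorem theorem7p1:
  fixes q :: "'a::field_char_0" and Beck :: "nat \<Rightarrow> 'a vec" and n :: nat
  assumes "q \<noteq> 0"
    and "\<forall>m::nat. 0 < m \<longrightarrow> q ^ m \<noteq> 1"
    and "\<forall>k\<ge>1. expco (\<lambda>j. vscale (q - inverse q) (Beck j)) k
                 = vscale (- (q - inverse q)) (Edel q k)"
    and "1 \<le> n"
  shows "natural q (Beck n) =
           vscale (qint q (int (2 * n)) / of_nat n * q powi (- int (2 * n)) * (q - inverse q) ^ (2 * n - 1))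
                  (conc (conc (single [X]) (Cat q (n - 1))) (single [Y]))"
proof -
  interpret generic_q q using assms(1,2) by unfold_locales auto
  let ?a = "\<lambda>j. vscale d (Beck j)"
  \<comment> \<open>The exponential identity is solved for its one-part term; all other terms have
    smaller indices.\<close>
  have fin: "finsupp (?a k)" if "1 \<le> k" for k
    using that
  proof (induction k rule: less_induct)
    case (less k)
    let ?R = "\<Sum>m\<in>{2..k}. vscale (1 / fact m) (\<Sum>ks\<in>comps k m. cprod (map ?a ks))"
    have "expco ?a k = ?a k + ?R"
      using sum_comps_split[OF less.prems, of "\<lambda>ks. cprod (map ?a ks)"] by (simp add: expco_eq conc_one)
    then have "?a k = vscale (- d) (Edel q k) - ?R"
      using assms(3) less.prems by (simp add: eq_diff_eq)
    moreover have "finsupp (vscale (- d) (Edel q k) - ?R)"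
      by (intro finsupp_diff finsupp_vscale finsupp_Edel finsupp_sum finsupp_cprod)
         (auto dest: comps_less intro!: less.IH simp: Suc_le_eq)
    ultimately show ?case by (simp only:)
  qed
  \<comment> \<open>Both sequences have the same exponential in the q-shuffle algebra, so they
    agree.\<close>
  have "img (?a n) = beck n"
  proof (rule sexp_inj[OF _ assms(4)])
    fix k :: nat assume "1 \<le> k"
    then have "expco ?a k = vscale (- d) (Edel q k)" using assms(3) by blast
    with \<open>1 \<le> k\<close> show "sexp (\<lambda>k. img (?a k)) k = sexp beck k"
      by (simp only: img_expco[symmetric] img_Edel sexp_beck)
  qed
  moreover have "finsupp (Beck n)"
    using fin[OF assms(4)] by (rule finsupp_subset) (use d_nz in \<open>simp add: pointwise\<close>)
  ultimately have "vscale d (natural q (Beck n)) = beck n"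
    by (simp add: natural_eq_img img_linear)
  also have "beck n = vscale d (vscale (qint q (int (2 * n)) / of_nat n * q powi (- int (2 * n)) * d ^ (2 * n - 1)) (H (n - 1)))"
  proof -
    \<comment> \<open>Of the 2n factors \<open>d\<close> in \<open>r ^ n\<close>, one cancels the
      scalar in the exponent, which leaves the power 2n-1.\<close>
    have "r ^ n = inverse (q ^ (2 * n)) * d ^ (2 * n)"
      by (simp add: power_mult_distrib power_mult power_inverse)
    moreover have "d ^ (2 * n) = d * d ^ (2 * n - 1)"
      using assms(4) by (simp flip: power_Suc)
    moreover have "q powi (- int (2 * n)) = inverse (q ^ (2 * n))"
      by (simp only: power_int_minus power_int_of_nat)
    ultimately show ?thesis by (simp only: beck_def vec.scale_scale mult_ac)
  qed
  finally have "natural q (Beck n) = vscale (qint q (int (2 * n)) / of_nat n * q powi (- int (2 * n)) * d ^ (2 * n - 1)) (H (n - 1))"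
    by (rule vscale_d_cancel)
  then show ?thesis by (simp only: H_def Xc_def x_def y_def)
qed

end
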